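(* Let $\mathsf{M}$ be a split matroid without loops and coloops, and let $T_{\mathsf{M}}(x,y)$ denote its Tutte polynomial. Then \[ T_{\mathsf{M}}(2,0)\cdot T_{\mathsf{M}}(0,2) \geq T_{\mathsf{M}}(1,1)^2.\]
   Context: A cyclic flat of a matroid is a flat that is a union of circuits. A connected split matroid is a connected matroid $\mathsf{M}$ on ground set $E$ whose proper cyclic flats form a clutter: whenever $F_1\subsetneq F_2$ are cyclic flats of $\mathsf{M}$, either $F_1=\varnothing$ or $F_2=E$. A split matroid is a matroid isomorphic to a direct sum in which exactly one summand is a connected split matroid and all remaining summands are uniform matroids. *)

theory Defs
  imports Main
begin

record 'a matroid_data =
  ground :: "'a set"
  indep :: "'a set set"

locale matroid =
  fixes M :: "'a matroid_data"
  assumes finite_ground: "finite (ground M)"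
    and indep_subset_ground: "X \<in> indep M \<Longrightarrow> X \<subseteq> ground M"
    and empty_indep: "{} \<in> indep M"
    and indep_downward: "X \<in> indep M \<Longrightarrow> Y \<subseteq> X \<Longrightarrow> Y \<in> indep M"
    and indep_augment: "X \<in> indep M \<Longrightarrow> Y \<in> indep M \<Longrightarrow> card X < card Y
          \<Longrightarrow> \<exists>e\<in>Y - X. insert e X \<in> indep M"

definition matroid_rank :: "'a matroid_data \<Rightarrow> 'a set \<Rightarrow> nat" where
  "matroid_rank M A = Max (card ` {X \<in> indep M. X \<subseteq> A})"

definition basis :: "'a matroid_data \<Rightarrow> 'a set \<Rightarrow> bool" where
  "basis M B \<longleftrightarrow> B \<in> indep M \<and> (\<forall>X\<in>indep M. B \<subseteq> X \<longrightarrow> X = B)"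

definition circuit :: "'a matroid_data \<Rightarrow> 'a set \<Rightarrow> bool" where
  "circuit M C \<longleftrightarrow> C \<subseteq> ground M \<and> C \<notin> indep M \<and> (\<forall>X. X \<subset> C \<longrightarrow> X \<in> indep M)"

definition loop :: "'a matroid_data \<Rightarrow> 'a \<Rightarrow> bool" where
  "loop M e \<longleftrightarrow> e \<in> ground M \<and> {e} \<notin> indep M"

definition coloop :: "'a matroid_data \<Rightarrow> 'a \<Rightarrow> bool" where
  "coloop M e \<longleftrightarrow> e \<in> ground M \<and> (\<forall>B. basis M B \<longrightarrow> e \<in> B)"

definition flat :: "'a matroid_data \<Rightarrow> 'a set \<Rightarrow> bool" where
  "flat M F \<longleftrightarrow> F \<subseteq> ground M \<and> (\<forall>e\<in>ground M - F. matroid_rank M F < matroid_rank M (insert e F))"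

definition cyclic_flat :: "'a matroid_data \<Rightarrow> 'a set \<Rightarrow> bool" where
  "cyclic_flat M F \<longleftrightarrow> flat M F \<and> (\<exists>\<C>. (\<forall>C\<in>\<C>. circuit M C) \<and> F = \<Union>\<C>)"

definition connected_matroid :: "'a matroid_data \<Rightarrow> bool" where
  "connected_matroid M \<longleftrightarrow> (\<forall>e\<in>ground M. \<forall>f\<in>ground M. e \<noteq> f \<longrightarrow>
     (\<exists>C. circuit M C \<and> e \<in> C \<and> f \<in> C))"

definition uniform_matroid :: "'a matroid_data \<Rightarrow> bool" where
  "uniform_matroid M \<longleftrightarrow> finite (ground M) \<and>
     (\<exists>k\<le>card (ground M). indep M = {X. X \<subseteq> ground M \<and> card X \<le> k})"

text \<open>The ground set of the direct sum is the disjoint union of the ground sets, realised by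
  tagging each element with the index of its summand.\<close>

definition direct_sum :: "'i set \<Rightarrow> ('i \<Rightarrow> 'a matroid_data) \<Rightarrow> ('i \<times> 'a) matroid_data" where
  "direct_sum I N = \<lparr>ground = (SIGMA i:I. ground (N i)),
     indep = {(SIGMA i:I. X i) | X. \<forall>i\<in>I. X i \<in> indep (N i)}\<rparr>"

definition isomorphic :: "'a matroid_data \<Rightarrow> 'b matroid_data \<Rightarrow> bool" where
  "isomorphic M N \<longleftrightarrow> (\<exists>f. bij_betw f (ground M) (ground N) \<and>
     (\<forall>X. X \<subseteq> ground M \<longrightarrow> (X \<in> indep M \<longleftrightarrow> f ` X \<in> indep N)))"

definition connected_split_matroid :: "'a matroid_data \<Rightarrow> bool" where
  "connected_split_matroid M \<longleftrightarrow> matroid M \<and> connected_matroid M \<and>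
     (\<forall>F1 F2. cyclic_flat M F1 \<and> cyclic_flat M F2 \<and> F1 \<subset> F2 \<longrightarrow> F1 = {} \<or> F2 = ground M)"

text \<open>One distinguished summand is a connected split matroid and all others are uniform; the
  uniform summands may themselves happen to be connected (and hence connected split).
  Since the ground set of each summand embeds into that of \<open>M\<close>, taking the summands on the
  element type of \<open>M\<close> is no restriction.\<close>

definition split_matroid :: "'a matroid_data \<Rightarrow> bool" where
  "split_matroid M \<longleftrightarrow> matroid M \<and>
     (\<exists>(n::nat) (N :: nat \<Rightarrow> 'a matroid_data) k. k < n \<and>
        connected_split_matroid (N k) \<and>
        (\<forall>i<n. i \<noteq> k \<longrightarrow> uniform_matroid (N i)) \<and>
        isomorphic M (direct_sum {..<n} N))"

definition tutte :: "'a matroid_data \<Rightarrow> 'b::comm_ring_1 \<Rightarrow> 'b \<Rightarrow> 'b" where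
  "tutte M x y = (\<Sum>A\<in>Pow (ground M).
     (x - 1) ^ (matroid_rank M (ground M) - matroid_rank M A) * (y - 1) ^ (card A - matroid_rank M A))"

end

theory Submission
  imports Defs "HOL-Library.FuncSet"
begin

text \<open>
  Both sides are multiplicative over direct sums, so it suffices to treat each summand. The
  summands exclude the minor \<open>U\<^bsub>0,1\<^esub> \<oplus> U\<^bsub>1,2\<^esub> \<oplus> U\<^bsub>1,1\<^esub>\<close>, a condition that is closed under minors and
  duality. If \<open>M \<setminus> e\<close> has no coloops and \<open>M / e\<close> has no loops, then deletion-contraction and the
  Cauchy-Schwarz inequality give the claim for \<open>M\<close> by induction. Otherwise every element lies in a
  series or a parallel pair. By duality the rank may be assumed to be at most the corank. In rank
  at least 3 the excluded minor leaves only one nontrivial parallel and one nontrivial series class, so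
  that \<open>M\<close> is a cycle with one edge replaced by parallel edges, or the direct sum of a cycle and a
  bundle of parallel edges; in rank 2 a whole parallel class can be removed at once. The remaining
  matroids are computed explicitly.
\<close>

section \<open>Rank functions, minors and duality\<close>

text \<open>The obstacle is that a loop makes \<open>acyc\<close> vanish and a coloop makes
  \<open>cyc\<close> vanish, while \<open>nbases\<close> stays positive. The inequality is therefore
  false for minors with loops or coloops, and the induction must not visit them; this forces the
  split into elements that can be removed safely and irreducible matroids. Deletion and contraction
  may destroy connectedness, and cyclic flats of minors are awkward to follow, so the induction runs
  on \<open>elementary_split\<close>, a condition on ranks alone. Bare rank functions serve the same
  end: minors and duals are then given by arithmetic formulas on the same element type. The
  normalisation by duality matters in the irreducible case: if the rank is at least 3 and at most
  half the number of elements, then the corank is at least 3 too, so the uniqueness of the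
  nontrivial parallel class holds both for the matroid and for its dual, where it speaks about
  series classes. Rank 2 stands apart: a loopless matroid of rank 2 never has the excluded minor, so
  the number of parallel classes is unrestricted.\<close>

locale rank_function =
  fixes E :: "'a set" and r :: "'a set \<Rightarrow> nat"
  assumes finite_E: "finite E"
    and rank_le_card: "A \<subseteq> E \<Longrightarrow> r A \<le> card A"
    and rank_mono: "A \<subseteq> B \<Longrightarrow> B \<subseteq> E \<Longrightarrow> r A \<le> r B"
    and rank_submod: "A \<subseteq> E \<Longrightarrow> B \<subseteq> E \<Longrightarrow> r (A \<union> B) + r (A \<inter> B) \<le> r A + r B"

text \<open>\<open>acyc\<close>, \<open>cyc\<close> and \<open>nbases\<close> are the values of the Tutte polynomial at (2,0), (0,2) and (1,1).
  Sums replace the truncated differences in the exponents of \<open>-1\<close>, which only matter modulo 2.\<close>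

definition acyc :: "'a set \<Rightarrow> ('a set \<Rightarrow> nat) \<Rightarrow> int" where
  "acyc E r = (\<Sum>A\<in>Pow E. (-1) ^ (card A + r A))"

definition cyc :: "'a set \<Rightarrow> ('a set \<Rightarrow> nat) \<Rightarrow> int" where
  "cyc E r = (\<Sum>A\<in>Pow E. (-1) ^ (r E + r A))"

definition nbases :: "'a set \<Rightarrow> ('a set \<Rightarrow> nat) \<Rightarrow> int" where
  "nbases E r = (\<Sum>A\<in>Pow E. of_bool (card A = r E \<and> r A = r E))"

text \<open>The two signs belong to the property because the inequality is propagated by
  \<open>cauchy_schwarz_step\<close>, which takes them as hypotheses.\<close>

definition merino_welsh :: "'a set \<Rightarrow> ('a set \<Rightarrow> nat) \<Rightarrow> bool" where
  "merino_welsh E r \<longleftrightarrow> 0 \<le> acyc E r \<and> 0 \<le> cyc E r \<and> (nbases E r)\<^sup>2 \<le> acyc E r * cyc E r"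

definition loopless :: "'a set \<Rightarrow> ('a set \<Rightarrow> nat) \<Rightarrow> bool" where
  "loopless E r \<longleftrightarrow> (\<forall>e\<in>E. r {e} = 1)"

definition coloopless :: "'a set \<Rightarrow> ('a set \<Rightarrow> nat) \<Rightarrow> bool" where
  "coloopless E r \<longleftrightarrow> (\<forall>e\<in>E. r (E - {e}) = r E)"

text \<open>After contracting \<open>S\<close> and restricting to \<open>{l, a, b, c}\<close>, the element \<open>l\<close> would be a loop, \<open>a\<close> and \<open>b\<close>
  parallel and \<open>c\<close> a coloop.\<close>

definition elementary_split :: "'a set \<Rightarrow> ('a set \<Rightarrow> nat) \<Rightarrow> bool" where
  "elementary_split E r \<longleftrightarrow> (\<nexists>S l a b c. S \<subseteq> E \<and> {l, a, b, c} \<subseteq> E - S \<and> a \<noteq> b \<and>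
     r (insert l S) = r S \<and> r (insert a S) = Suc (r S) \<and> r (insert b S) = Suc (r S) \<and>
     r (insert a (insert b S)) = Suc (r S) \<and>
     r (insert c (insert a (insert b S))) = Suc (Suc (r S)))"

lemma elementary_splitD:
  assumes "elementary_split E r" "S \<subseteq> E" "{l, a, b, c} \<subseteq> E - S" "a \<noteq> b"
    "r (insert l S) = r S" "r (insert a S) = Suc (r S)" "r (insert b S) = Suc (r S)"
    "r (insert a (insert b S)) = Suc (r S)"
    "r (insert c (insert a (insert b S))) = Suc (Suc (r S))"
  shows False
proof -
  have "\<exists>S l a b c. S \<subseteq> E \<and> {l, a, b, c} \<subseteq> E - S \<and> a \<noteq> b \<and>
     r (insert l S) = r S \<and> r (insert a S) = Suc (r S) \<and> r (insert b S) = Suc (r S) \<and>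
     r (insert a (insert b S)) = Suc (r S) \<and>
     r (insert c (insert a (insert b S))) = Suc (Suc (r S))"
    by (intro exI conjI) (fact assms)+
  then show False using assms(1) unfolding elementary_split_def by (rule notE[rotated])
qed

definition contraction :: "('a set \<Rightarrow> nat) \<Rightarrow> 'a \<Rightarrow> 'a set \<Rightarrow> nat" where
  "contraction r e A = r (insert e A) - r {e}"

definition dual_rank :: "'a set \<Rightarrow> ('a set \<Rightarrow> nat) \<Rightarrow> 'a set \<Rightarrow> nat" where
  "dual_rank E r A = card A + r (E - A) - r E"

section \<open>Sums over subsets and exponential bounds\<close>

lemma cauchy_schwarz_step:
  fixes a1 a2 b1 b2 t1 t2 :: int
  assumes "0 \<le> a1" "0 \<le> b1" "0 \<le> a2" "0 \<le> b2" "t1\<^sup>2 \<le> a1 * b1" "t2\<^sup>2 \<le> a2 * b2"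
  shows "(t1 + t2)\<^sup>2 \<le> (a1 + a2) * (b1 + b2)"
proof -
  \<comment> \<open>Square roots are avoided: the square of \<open>t1 * t2\<close> is at most the
    product of \<open>a1 * b2\<close> and \<open>a2 * b1\<close>, and AM-GM turns this into a bound
    by the mixed terms of the right-hand side.\<close>
  have "(t1 * t2)\<^sup>2 \<le> (a1 * b1) * (a2 * b2)"
    unfolding power_mult_distrib by (rule mult_mono) (use assms in auto)
  then have "(2 * (t1 * t2))\<^sup>2 \<le> 4 * ((a1 * b2) * (a2 * b1))"
    by (simp add: power_mult_distrib algebra_simps)
  also have "\<dots> \<le> (a1 * b2 + a2 * b1)\<^sup>2"
    using zero_le_power2[of "a1 * b2 - a2 * b1"] by (simp add: power2_eq_square algebra_simps)
  finally have "2 * (t1 * t2) \<le> a1 * b2 + a2 * b1"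
    by (rule power2_le_imp_le) (use assms in auto)
  with assms(5,6) show ?thesis
    by (simp add: power2_eq_square algebra_simps)
qed

lemma sum_Pow_Un:
  fixes g :: "'a set \<Rightarrow> 'b::comm_monoid_add"
  assumes "P \<inter> Q = {}"
  shows "(\<Sum>A\<in>Pow (P \<union> Q). g A) = (\<Sum>X\<in>Pow P. \<Sum>Y\<in>Pow Q. g (X \<union> Y))"
proof -
  have "(\<Sum>A\<in>Pow (P \<union> Q). g A) = (\<Sum>(X, Y)\<in>Pow P \<times> Pow Q. g (X \<union> Y))"
    by (rule sum.reindex_bij_witness[of _ "\<lambda>(X, Y). X \<union> Y" "\<lambda>A. (A \<inter> P, A \<inter> Q)"])
       (use assms in \<open>auto simp flip: Int_Un_distrib intro!: arg_cong[of _ _ g]\<close>)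
  then show ?thesis by (simp add: sum.cartesian_product)
qed

lemma sum_Pow_insert:
  fixes g :: "'a set \<Rightarrow> 'b::comm_monoid_add"
  assumes "e \<in> E"
  shows "(\<Sum>A\<in>Pow E. g A) = (\<Sum>A\<in>Pow (E - {e}). g A) + (\<Sum>A\<in>Pow (E - {e}). g (insert e A))"
proof -
  have "E = {e} \<union> (E - {e})" using assms by auto
  then have "(\<Sum>A\<in>Pow E. g A) = (\<Sum>X\<in>Pow {e}. \<Sum>Y\<in>Pow (E - {e}). g (X \<union> Y))"
    using sum_Pow_Un[of "{e}" "E - {e}" g] by auto
  then show ?thesis by (simp add: Pow_insert add.commute)
qed

lemma sum_Pow_neg1:
  assumes "finite Q" "Q \<noteq> {}"
  shows "(\<Sum>Y\<in>Pow Q. (-1) ^ card Y) = (0::int)"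
proof -
  obtain q where q: "q \<in> Q" using assms by auto
  have "(\<Sum>Y\<in>Pow (Q - {q}). (-1) ^ card (insert q Y)) = (\<Sum>Y\<in>Pow (Q - {q}). - ((-1::int) ^ card Y))"
  proof (rule sum.cong)
    fix Y assume Y: "Y \<in> Pow (Q - {q})"
    then have "finite Y" using assms(1) finite_subset by auto
    with Y show "(-1) ^ card (insert q Y) = - ((-1::int) ^ card Y)" by (subst card_insert_disjoint) auto
  qed simp
  then show ?thesis by (subst sum_Pow_insert[OF q]) (simp add: sum_negf)
qed

text \<open>The sums over Q that arise in rank 2. The values 1 and 2 are the rank of Y together with
  an element of a parallel class disjoint from Q; the values 0 and 1 are the rank of Y when Q is
  itself a parallel class.\<close>

lemma sum_Pow_case_empty:
  assumes Q: "finite Q" "Q \<noteq> {}"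
  shows "(\<Sum>Y\<in>Pow Q. (-1) ^ (card Y + (if Y = {} then 1 else 2))) = (- 2 :: int)"
    "(\<Sum>Y\<in>Pow Q. (-1) ^ (2 + (if Y = {} then 1 else 2))) = (2 ^ card Q - 2 :: int)"
    "(\<Sum>Y\<in>Pow Q. of_bool (Suc (card Y) = 2 \<and> (if Y = {} then 1 else 2) = (2::nat))) = int (card Q)"
    "(\<Sum>Y\<in>Pow Q. (-1) ^ (card Y + (if Y = {} then 0 else 1))) = (2 :: int)"
    "(\<Sum>Y\<in>Pow Q. (-1) ^ (2 + (if Y = {} then 0 else 1))) = (2 - 2 ^ card Q :: int)"
proof -
  have split: "(\<Sum>Y\<in>Pow Q. g Y) = g {} + (\<Sum>Y\<in>Pow Q - {{}}. g Y)" for g :: "'a set \<Rightarrow> int"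
    by (rule sum.remove) (use Q in auto)
  have alt: "(\<Sum>Y\<in>Pow Q - {{}}. (-1) ^ card Y) = (-1 :: int)"
    using sum_Pow_neg1[OF Q] split[of "\<lambda>Y. (-1) ^ card Y"] by simp
  have one: "(\<Sum>Y\<in>Pow Q - {{}}. 1) = (2 ^ card Q - 1 :: int)"
    using Q by (simp add: card_Diff_singleton card_Pow of_nat_diff)
  have "(\<Sum>Y\<in>Pow Q - {{}}. (-1) ^ (card Y + (if Y = {} then 1 else 2))) = (\<Sum>Y\<in>Pow Q - {{}}. (-1 :: int) ^ card Y)"
    by (rule sum.cong) auto
  then show "(\<Sum>Y\<in>Pow Q. (-1) ^ (card Y + (if Y = {} then 1 else 2))) = (- 2 :: int)"
    unfolding split alt by simp
  have "(\<Sum>Y\<in>Pow Q - {{}}. (-1) ^ (2 + (if Y = {} then 1 else 2))) = (\<Sum>Y\<in>Pow Q - {{}}. 1 :: int)"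
    by (rule sum.cong) auto
  then show "(\<Sum>Y\<in>Pow Q. (-1) ^ (2 + (if Y = {} then 1 else 2))) = (2 ^ card Q - 2 :: int)"
    unfolding split one by simp
  have "(\<Sum>Y\<in>Pow Q - {{}}. (-1) ^ (card Y + (if Y = {} then 0 else 1))) = (\<Sum>Y\<in>Pow Q - {{}}. -1 * (-1 :: int) ^ card Y)"
    by (rule sum.cong) auto
  then show "(\<Sum>Y\<in>Pow Q. (-1) ^ (card Y + (if Y = {} then 0 else 1))) = (2 :: int)"
    unfolding split sum_distrib_left[symmetric] alt by simp
  have "(\<Sum>Y\<in>Pow Q - {{}}. (-1) ^ (2 + (if Y = {} then 0 else 1))) = (\<Sum>Y\<in>Pow Q - {{}}. -1 * 1 :: int)"
    by (rule sum.cong) auto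
  then show "(\<Sum>Y\<in>Pow Q. (-1) ^ (2 + (if Y = {} then 0 else 1))) = (2 - 2 ^ card Q :: int)"
    unfolding split sum_distrib_left[symmetric] one by simp
  have "{Y \<in> Pow Q. Suc (card Y) = 2 \<and> (if Y = {} then 1 else 2) = (2::nat)} = (\<lambda>x. {x}) ` Q"
    by (auto simp: card_1_singleton_iff)
  moreover have "card ((\<lambda>x. {x}) ` Q) = card Q" by (rule card_image) auto
  ultimately show "(\<Sum>Y\<in>Pow Q. of_bool (Suc (card Y) = 2 \<and> (if Y = {} then 1 else 2) = (2::nat))) = int (card Q)"
    using Q by (simp add: Int_def)
qed

text \<open>The inequality of the theorem for the uniform matroid of rank 1 on n elements, whose
  invariants are 2, \<open>2 ^ n - 2\<close> and n.\<close>

lemma square_le_exp: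
  assumes "2 \<le> (n::nat)"
  shows "(int n)\<^sup>2 \<le> 2 * (2 ^ n - 2)"
  using assms
proof (induction n rule: dec_induct)
  case (step n)
  have "(int (Suc n))\<^sup>2 = (int n)\<^sup>2 + 2 * int n + 1" by (simp add: power2_eq_square algebra_simps)
  moreover have "2 * int n \<le> (int n)\<^sup>2" using step.hyps by (simp add: power2_eq_square)
  moreover have "(4::int) \<le> 2 ^ n" using power_increasing[of 2 n "2::int"] step.hyps by simp
  ultimately show ?case using step.IH step.hyps
    by (cases "n = 2") auto
qed simp

text \<open>For a cycle with one edge replaced by parallel edges, \<open>acyc\<close> and
  \<open>cyc\<close> have the form of the right-hand side. Equality holds for n at most 2.\<close>

lemma oblong_le_exp: "int n * (int n + 1) \<le> 2 ^ Suc n - 2"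
proof (induction n)
  case (Suc n)
  have "int n + 1 \<le> 2 ^ n" by (induction n) auto
  with Suc show ?case by (simp add: algebra_simps)
qed simp

text \<open>Equality at n = 2 dictates the constant: the square of n exceeds
  \<open>2 ^ n - 1\<close> for n = 2, 3, 4, by a factor of at most 4/3.\<close>

lemma square_le_exp_3_4: "3 * (int n)\<^sup>2 \<le> 4 * (2 ^ n - 1)"
proof -
  consider "n = 0" | "n = 1" | "n = 2" | "3 \<le> n" by linarith
  then show ?thesis
  proof cases
    case 4
    then show ?thesis
    proof (induction n rule: dec_induct)
      case (step n)
      \<comment> \<open>With t = n, q the square of n and p = \<open>2 ^ n\<close>, the induction
        step becomes linear; \<open>3 * t \<le> q\<close> says that n is at least 3, which is why
        the induction starts there.\<close>
      have *: "3 * (q + 2 * t + 1) \<le> 4 * (2 * p - 1)"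
        if "0 \<le> t" "3 * t \<le> q" "3 * q \<le> 4 * (p - 1)" for p q t :: int
        using that by (simp add: algebra_simps)
      have "3 * int n \<le> (int n)\<^sup>2" using step.hyps by (simp add: power2_eq_square)
      from *[OF _ this step.IH] show ?case by (simp add: power2_eq_square algebra_simps)
    qed simp
  qed auto
qed

text \<open>A sharpening of \<open>square_le_exp\<close> by the factor that
  \<open>square_le_exp_3_4\<close> loses. Equality holds at n = 3, and n = 2 violates it.\<close>

lemma square_le_exp_4_3:
  assumes "3 \<le> (n::nat)"
  shows "4 * (int n)\<^sup>2 \<le> 3 * (2 * (2 ^ n - 2))"
  using assms
proof (induction n rule: dec_induct)
  case (step n)
  have *: "4 * (q + 2 * t + 1) \<le> 3 * (2 * (2 * p - 2))"
    if "0 \<le> t" "3 * t \<le> q" "4 * q \<le> 3 * (2 * (p - 2))" for p q t :: int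
    using that by (simp add: algebra_simps)
  have "3 * int n \<le> (int n)\<^sup>2" using step.hyps by (simp add: power2_eq_square)
  from *[OF _ this step.IH] show ?case by (simp add: power2_eq_square algebra_simps)
qed simp

section \<open>Closure, minors and duality\<close>

context rank_function
begin

lemma finite_sub: "A \<subseteq> E \<Longrightarrow> finite A"
  using finite_E finite_subset by blast

lemma rank_empty: "r {} = 0"
  using rank_le_card[of "{}"] by simp

lemma rank_Un_le: "A \<subseteq> E \<Longrightarrow> B \<subseteq> E \<Longrightarrow> r (A \<union> B) \<le> r A + r B"
  using rank_submod[of A B] by simp

lemma rank_Un_card: "A \<subseteq> E \<Longrightarrow> B \<subseteq> E \<Longrightarrow> r (A \<union> B) \<le> r A + card B"
  using rank_Un_le[of A B] rank_le_card[of B] by simp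

lemma rank_insert_le: "A \<subseteq> E \<Longrightarrow> e \<in> E \<Longrightarrow> r (insert e A) \<le> Suc (r A)"
  using rank_Un_card[of A "{e}"] by simp

lemma rank_insert_ge: "A \<subseteq> E \<Longrightarrow> e \<in> E \<Longrightarrow> r A \<le> r (insert e A)"
  by (rule rank_mono) auto

text \<open>Monotonicity of closure, from submodularity. Its contrapositive carries a rank increase
  from a set down to its subsets.\<close>

lemma rank_insert_mono:
  assumes "A \<subseteq> B" "B \<subseteq> E" "e \<in> E" "r (insert e A) = r A"
  shows "r (insert e B) = r B"
proof (cases "e \<in> B")
  case False
  have "r (insert e A \<union> B) + r (insert e A \<inter> B) \<le> r (insert e A) + r B"
    using assms by (intro rank_submod) auto
  moreover have "insert e A \<union> B = insert e B" "insert e A \<inter> B = A" using assms False by auto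
  ultimately show ?thesis using assms rank_insert_ge[of B e] by simp
qed (simp add: insert_absorb)

lemma rank_absorb:
  assumes "A \<subseteq> E" "B \<subseteq> E" "\<And>e. e \<in> B \<Longrightarrow> r (insert e A) = r A"
  shows "r (A \<union> B) = r A"
proof -
  have "finite B" using assms finite_sub by blast
  then show ?thesis using assms(2,3)
  proof (induction B)
    case (insert e B)
    have "r (insert e (A \<union> B)) = r (A \<union> B)"
      by (rule rank_insert_mono[of A]) (use insert.prems assms(1) in auto)
    then show ?case using insert by auto
  qed simp
qed

lemma rank_one_subset:
  assumes "loopless E r" "A \<subseteq> E" "A \<noteq> {}" "r A \<le> 1"
  shows "r A = 1"
proof -
  obtain a where "a \<in> A" using assms by auto
  then show ?thesis using assms rank_mono[of "{a}" A] unfolding loopless_def by fastforce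
qed

lemma rank_function_subset: "E' \<subseteq> E \<Longrightarrow> rank_function E' r"
  by unfold_locales (auto intro: finite_sub rank_le_card rank_mono rank_submod)

lemma elementary_split_subset:
  assumes "E' \<subseteq> E" "elementary_split E r"
  shows "elementary_split E' r"
  unfolding elementary_split_def
proof (rule notI, elim exE conjE)
  fix S l a b c
  assume "S \<subseteq> E'" "{l, a, b, c} \<subseteq> E' - S" and h: "a \<noteq> b"
      "r (insert l S) = r S" "r (insert a S) = Suc (r S)" "r (insert b S) = Suc (r S)"
      "r (insert a (insert b S)) = Suc (r S)"
      "r (insert c (insert a (insert b S))) = Suc (Suc (r S))"
  then have "S \<subseteq> E" "{l, a, b, c} \<subseteq> E - S" using assms(1) by auto
  then show False using h by (rule elementary_splitD[OF assms(2)])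
qed

lemma contraction_eq: "e \<in> E \<Longrightarrow> A \<subseteq> E \<Longrightarrow> contraction r e A + r {e} = r (insert e A)"
  unfolding contraction_def using rank_mono[of "{e}" "insert e A"] by auto

lemma rank_function_contraction:
  assumes e: "e \<in> E"
  shows "rank_function (E - {e}) (contraction r e)"
proof
  show "finite (E - {e})" using finite_E by simp
next
  fix A assume "A \<subseteq> E - {e}"
  then show "contraction r e A \<le> card A"
    unfolding contraction_def using rank_Un_card[of "{e}" A] e by (simp add: subset_Diff_insert)
next
  fix A B assume "A \<subseteq> B" "B \<subseteq> E - {e}"
  then show "contraction r e A \<le> contraction r e B"
    unfolding contraction_def using e by (intro diff_le_mono rank_mono) auto
next
  fix A B assume A: "A \<subseteq> E - {e}" and B: "B \<subseteq> E - {e}"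
  have "r (insert e A \<union> insert e B) + r (insert e A \<inter> insert e B) \<le> r (insert e A) + r (insert e B)"
    using A B e by (intro rank_submod) auto
  then have "r (insert e (A \<union> B)) + r (insert e (A \<inter> B)) \<le> r (insert e A) + r (insert e B)"
    by simp
  moreover have "contraction r e (A \<union> B) + r {e} = r (insert e (A \<union> B))"
    "contraction r e (A \<inter> B) + r {e} = r (insert e (A \<inter> B))"
    "contraction r e A + r {e} = r (insert e A)" "contraction r e B + r {e} = r (insert e B)"
    using A B e by (auto intro!: contraction_eq)
  ultimately show "contraction r e (A \<union> B) + contraction r e (A \<inter> B)
      \<le> contraction r e A + contraction r e B" by linarith
qed

text \<open>All ranks shift by the same \<open>r {e}\<close>, so an obstruction over S in the
  contraction is one over \<open>insert e S\<close> in the original matroid.\<close>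

lemma elementary_split_contraction:
  assumes e: "e \<in> E" and es: "elementary_split E r"
  shows "elementary_split (E - {e}) (contraction r e)"
  unfolding elementary_split_def
proof (rule notI, elim exE conjE)
  fix S l a b c
  assume S: "S \<subseteq> E - {e}" and el: "{l, a, b, c} \<subseteq> E - {e} - S" and ab: "a \<noteq> b"
    and h: "contraction r e (insert l S) = contraction r e S"
      "contraction r e (insert a S) = Suc (contraction r e S)"
      "contraction r e (insert b S) = Suc (contraction r e S)"
      "contraction r e (insert a (insert b S)) = Suc (contraction r e S)"
      "contraction r e (insert c (insert a (insert b S))) = Suc (Suc (contraction r e S))"
  have c: "r (insert e A) = contraction r e A + r {e}" if "A \<subseteq> E" for A
    using contraction_eq[OF e that] by simp
  let ?S = "insert e S"
  have S': "S \<subseteq> E" using S by auto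
  have "r (insert l ?S) = r ?S" "r (insert a ?S) = Suc (r ?S)" "r (insert b ?S) = Suc (r ?S)"
    "r (insert a (insert b ?S)) = Suc (r ?S)"
    "r (insert c (insert a (insert b ?S))) = Suc (Suc (r ?S))"
    using c[of S] c[of "insert l S"] c[of "insert a S"] c[of "insert b S"]
      c[of "insert a (insert b S)"] c[of "insert c (insert a (insert b S))"] h S' el
    by (auto simp: insert_commute)
  moreover have "?S \<subseteq> E" "{l, a, b, c} \<subseteq> E - ?S" using S el e by auto
  ultimately show False using ab by (intro elementary_splitD[OF es, of ?S l a b c])
qed

lemma dual_rank_eq: "A \<subseteq> E \<Longrightarrow> dual_rank E r A + r E = card A + r (E - A)"
proof -
  assume A: "A \<subseteq> E"
  then have "r E \<le> r (E - A) + card A"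
    using rank_Un_card[of "E - A" A] by (simp add: Un_absorb2)
  then show ?thesis unfolding dual_rank_def by simp
qed

lemma rank_function_dual: "rank_function E (dual_rank E r)"
proof
  show "finite E" by (rule finite_E)
next
  fix A assume A: "A \<subseteq> E"
  then show "dual_rank E r A \<le> card A"
    using dual_rank_eq[OF A] rank_mono[of "E - A" E] by simp
next
  fix A B assume A: "A \<subseteq> B" and B: "B \<subseteq> E"
  have "r ((E - B) \<union> (B - A)) \<le> r (E - B) + card (B - A)"
    using B by (intro rank_Un_card) auto
  moreover have "(E - B) \<union> (B - A) = E - A" using A B by auto
  moreover have "card (B - A) + card A = card B"
    using A finite_sub[OF B] by (metis card_Diff_subset card_mono finite_subset le_add_diff_inverse2)
  ultimately show "dual_rank E r A \<le> dual_rank E r B"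
    using dual_rank_eq[of A] dual_rank_eq[OF B] subset_trans[OF A B] by simp
next
  fix A B assume A: "A \<subseteq> E" and B: "B \<subseteq> E"
  have "r ((E - A) \<union> (E - B)) + r ((E - A) \<inter> (E - B)) \<le> r (E - A) + r (E - B)"
    by (intro rank_submod) auto
  moreover have "(E - A) \<union> (E - B) = E - (A \<inter> B)" "(E - A) \<inter> (E - B) = E - (A \<union> B)" by auto
  moreover have "card (A \<union> B) + card (A \<inter> B) = card A + card B"
    using card_Un_Int finite_sub A B by metis
  moreover have "A \<union> B \<subseteq> E" "A \<inter> B \<subseteq> E" using A B by auto
  ultimately show "dual_rank E r (A \<union> B) + dual_rank E r (A \<inter> B) \<le> dual_rank E r A + dual_rank E r B"
    using dual_rank_eq[OF A] dual_rank_eq[OF B] dual_rank_eq[of "A \<union> B"] dual_rank_eq[of "A \<inter> B"]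
    by simp
qed

lemma dual_rank_E: "dual_rank E r E + r E = card E"
  using dual_rank_eq[of E] rank_empty by simp

lemma loopless_dual: "coloopless E r \<Longrightarrow> loopless E (dual_rank E r)"
  unfolding coloopless_def loopless_def by (auto simp: dual_rank_def)

lemma coloopless_dual: 
  assumes "loopless E r" shows "coloopless E (dual_rank E r)"
  unfolding coloopless_def
proof
  fix e assume e: "e \<in> E"
  have "E - (E - {e}) = {e}" using e by auto
  then show "dual_rank E r (E - {e}) = dual_rank E r E"
    using dual_rank_eq[of "E - {e}"] dual_rank_E e assms finite_E unfolding loopless_def
    by (simp add: card_Diff_singleton) (metis One_nat_def Suc_pred add_Suc_right card_gt_0_iff
        add_right_cancel empty_iff)
qed

text \<open>The excluded minor is self-dual: loop and coloop change places and the parallel pair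
  stays one. An obstruction (l, a, b, c) over S in the dual thus becomes (c, a, b, l) over the set D
  of all remaining elements.\<close>

lemma elementary_split_dual:
  assumes es: "elementary_split E r"
  shows "elementary_split E (dual_rank E r)"
  unfolding elementary_split_def
proof (rule notI, elim exE conjE)
  let ?d = "dual_rank E r"
  fix S l a b c
  assume S: "S \<subseteq> E" and el: "{l, a, b, c} \<subseteq> E - S" and ab: "a \<noteq> b"
    and h: "?d (insert l S) = ?d S" "?d (insert a S) = Suc (?d S)" "?d (insert b S) = Suc (?d S)"
      "?d (insert a (insert b S)) = Suc (?d S)"
      "?d (insert c (insert a (insert b S))) = Suc (Suc (?d S))"
  interpret d: rank_function E ?d by (rule rank_function_dual)
  define D where "D = E - S - {l, a, b, c}"
  \<comment> \<open>Apart from \<open>a \<noteq> b\<close>, distinctness of the four elements is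
    forced by their ranks.\<close>
  have ne: "l \<noteq> a" "l \<noteq> b" "c \<noteq> a" "c \<noteq> b" using h by (auto simp: insert_absorb insert_commute)
  have lT: "?d (insert l T) = ?d T" if "S \<subseteq> T" "T \<subseteq> E" for T
    using d.rank_insert_mono[of S T l] that h(1) el by auto
  have lc: "l \<noteq> c"
    using lT[OF subset_insertI2[OF subset_insertI], of a b] h el S by auto
  have fS: "finite S" using S finite_sub by auto
  have sub: "S \<subseteq> E" "insert a S \<subseteq> E" "insert b S \<subseteq> E" "insert a (insert b S) \<subseteq> E"
    "insert c S \<subseteq> E"
    using S el by auto
  \<comment> \<open>Since c raises the dual rank over S with both a and b added, it also does so
    over S with at most one of them.\<close>
  have cS: "?d (insert c S) = Suc (?d S)"
    using d.rank_insert_mono[of S "insert a (insert b S)" c] h sub el d.rank_insert_le[of S c]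
      d.rank_insert_ge[of S c] by force
  have cb: "?d (insert c (insert b S)) = Suc (Suc (?d S))"
    using d.rank_insert_mono[of "insert b S" "insert a (insert b S)" c] h sub el
      d.rank_insert_le[of "insert b S" c] d.rank_insert_ge[of "insert b S" c] by force
  have ca: "?d (insert c (insert a S)) = Suc (Suc (?d S))"
    using d.rank_insert_mono[of "insert a S" "insert a (insert b S)" c] h sub el
      d.rank_insert_le[of "insert a S" c] d.rank_insert_ge[of "insert a S" c] by force
  \<comment> \<open>Ranks over D are read off from complements. As l is a loop over S in the dual,
    it can be put into the set for free, which keeps it out of the complement; the
    \<open>Suc\<close> counts it.\<close>
  have g: "?d (U \<union> S) + r E = Suc (card U + card S) + r (({a, b, c} - U) \<union> D)"
    if U: "U \<subseteq> {a, b, c}" for U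
  proof -
    have "U \<inter> S = {}" "l \<notin> U \<union> S" and US: "U \<union> S \<subseteq> E" using U el ne lc S by auto
    moreover have "finite U" using U finite_subset by blast
    ultimately have "card (insert l (U \<union> S)) = Suc (card U + card S)"
      using fS by (simp add: card_Un_disjoint)
    moreover have "E - insert l (U \<union> S) = ({a, b, c} - U) \<union> D"
      using U el ne lc unfolding D_def by auto
    moreover have "insert l (U \<union> S) \<subseteq> E" using US el by auto
    ultimately show ?thesis
      using dual_rank_eq[of "insert l (U \<union> S)"] lT[OF Un_upper2 US] by simp
  qed
  have "r (insert c D) = r D" "r (insert a D) = Suc (r D)" "r (insert b D) = Suc (r D)"
    "r (insert a (insert b D)) = Suc (r D)"
    using g[of "{c, a, b}"] g[of "{a, b}"] g[of "{c, b}"] g[of "{c, a}"] g[of "{c}"]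
      h cS cb ca ab ne by (simp_all add: insert_Diff_if)
  \<comment> \<open>Here l has to lie in the complement, so \<open>g\<close> does not apply and
    \<open>insert c S\<close> is complemented directly.\<close>
  moreover have "r (insert l (insert a (insert b D))) = Suc (Suc (r D))"
  proof -
    have "E - insert c S = insert l (insert a (insert b D))" using el ne lc ab unfolding D_def by auto
    then have "?d (insert c S) + r E = card S + 1 + r (insert l (insert a (insert b D)))"
      using dual_rank_eq[of "insert c S"] sub(5) fS el by simp
    then show ?thesis using g[of "{c, a, b}"] cS h ab ne by (simp add: insert_Diff_if)
  qed
  moreover have "D \<subseteq> E" "{c, a, b, l} \<subseteq> E - D" using el unfolding D_def by auto
  ultimately show False using ab by (intro elementary_splitD[OF es, of D c a b l])
qed

lemma acyc_dual: "acyc E (dual_rank E r) = cyc E r"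
  unfolding acyc_def cyc_def
proof (rule sum.reindex_bij_witness[of _ "\<lambda>A. E - A" "\<lambda>A. E - A"])
  fix A assume "A \<in> Pow E"
  then have "dual_rank E r A + r E = card A + r (E - A)" using dual_rank_eq by simp
  then show "(-1) ^ (r E + r (E - A)) = (- 1 :: int) ^ (card A + dual_rank E r A)"
    by (auto simp: minus_one_power_iff dest: arg_cong[of _ _ even])
qed auto

lemma nbases_dual: "nbases E (dual_rank E r) = nbases E r"
  unfolding nbases_def
proof (rule sum.reindex_bij_witness[of _ "\<lambda>A. E - A" "\<lambda>A. E - A"])
  fix A assume A: "A \<in> Pow E"
  then have "card (E - A) + card A = card E"
    using finite_E by (simp add: card_Diff_subset card_mono finite_subset)
  then show "of_bool (card (E - A) = r E \<and> r (E - A) = r E)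
      = (of_bool (card A = dual_rank E r E \<and> dual_rank E r A = dual_rank E r E) :: int)"
    using dual_rank_eq[of A] dual_rank_E rank_mono[of "E - A" E] A by auto
qed auto

lemma cyc_dual: "cyc E (dual_rank E r) = acyc E r"
  unfolding acyc_def cyc_def
proof (rule sum.reindex_bij_witness[of _ "\<lambda>A. E - A" "\<lambda>A. E - A"])
  fix A assume A: "A \<in> Pow E"
  then have "card (E - A) + card A = card E"
    using finite_E by (simp add: card_Diff_subset card_mono finite_subset)
  then have "dual_rank E r E + dual_rank E r A + 2 * r E = card (E - A) + r (E - A) + 2 * card A"
    using dual_rank_eq[of A] dual_rank_E A by simp
  then show "(-1) ^ (card (E - A) + r (E - A)) = (- 1 :: int) ^ (dual_rank E r E + dual_rank E r A)"
    by (auto simp: minus_one_power_iff dest: arg_cong[of _ _ even])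
qed auto

lemma merino_welsh_dual: "merino_welsh E (dual_rank E r) \<longleftrightarrow> merino_welsh E r"
  unfolding merino_welsh_def acyc_dual cyc_dual nbases_dual by (auto simp: mult.commute)

section \<open>Deletion-contraction and parallel classes\<close>

lemma merino_welsh_deletion_contraction:
  assumes e: "e \<in> E" and nl: "r {e} = 1" and nc: "r (E - {e}) = r E"
    and del: "merino_welsh (E - {e}) r" and con: "merino_welsh (E - {e}) (contraction r e)"
  shows "merino_welsh E r"
proof -
  have c: "r (insert e A) = Suc (contraction r e A)" if "A \<subseteq> E" for A
    using contraction_eq[OF e that] nl by simp
  have cE: "r E = Suc (contraction r e (E - {e}))"
    using c[of "E - {e}"] e by (simp add: insert_absorb)
  have card: "card (insert e A) = Suc (card A)" if "A \<subseteq> E - {e}" for A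
    using that finite_sub[of A] by (subst card_insert_disjoint) auto
  have "acyc E r = acyc (E - {e}) r + acyc (E - {e}) (contraction r e)"
    unfolding acyc_def sum_Pow_insert[OF e]
    by (intro arg_cong2[of _ _ _ _ "(+)"] sum.cong refl) (simp add: c card subset_Diff_insert)
  moreover have "cyc E r = cyc (E - {e}) r + cyc (E - {e}) (contraction r e)"
    unfolding cyc_def sum_Pow_insert[OF e] nc
    by (intro arg_cong2[of _ _ _ _ "(+)"] sum.cong refl) (simp add: c cE subset_Diff_insert)
  moreover have "nbases E r = nbases (E - {e}) r + nbases (E - {e}) (contraction r e)"
    unfolding nbases_def sum_Pow_insert[OF e] nc
    by (intro arg_cong2[of _ _ _ _ "(+)"] sum.cong refl) (simp add: c cE card subset_Diff_insert)
  ultimately show ?thesis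
    using del con unfolding merino_welsh_def by (auto intro: cauchy_schwarz_step)
qed

text \<open>Elements of P are interchangeable: \<open>f Y\<close> is the rank of Y with any nonempty
  part X of P added. The sum over nonempty X therefore splits off as a factor: -1 with signs,
  \<open>2 ^ card P - 1\<close> without signs, and \<open>card P\<close> for bases, where X is a
  singleton.\<close>

lemma sum_parallel_class:
  assumes E: "E = P \<union> Q" and disj: "P \<inter> Q = {}" and P: "P \<noteq> {}"
    and f': "\<forall>X\<in>Pow P - {{}}. \<forall>Y\<in>Pow Q. r (X \<union> Y) = f Y"
  shows "acyc E r = (\<Sum>Y\<in>Pow Q. (-1) ^ (card Y + r Y)) - (\<Sum>Y\<in>Pow Q. (-1) ^ (card Y + f Y))"
    and "cyc E r = (\<Sum>Y\<in>Pow Q. (-1) ^ (f Q + r Y))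
           + (2 ^ card P - 1) * (\<Sum>Y\<in>Pow Q. (-1) ^ (f Q + f Y))"
    and "nbases E r = (\<Sum>Y\<in>Pow Q. of_bool (card Y = f Q \<and> r Y = f Q))
           + int (card P) * (\<Sum>Y\<in>Pow Q. of_bool (Suc (card Y) = f Q \<and> f Y = f Q))"
proof -
  have fin: "finite P" "finite Q" using finite_E E by auto
  have f: "r (X \<union> Y) = f Y" if "X \<subseteq> P" "X \<noteq> {}" "Y \<subseteq> Q" for X Y using f' that by auto
  have fE: "r E = f Q" using f[of P Q] E P by simp
  have split: "(\<Sum>A\<in>Pow E. g A) = (\<Sum>Y\<in>Pow Q. g Y) + (\<Sum>X\<in>Pow P - {{}}. \<Sum>Y\<in>Pow Q. g (X \<union> Y))"
    for g :: "'a set \<Rightarrow> int"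
    unfolding E sum_Pow_Un[OF disj] by (subst sum.remove[of _ "{}"]) (use fin in auto)
  have card: "card (X \<union> Y) = card X + card Y" if "X \<subseteq> P" "Y \<subseteq> Q" for X Y
    using that disj fin by (intro card_Un_disjoint) (auto intro: finite_subset)
  have alt: "(\<Sum>X\<in>Pow P - {{}}. (-1) ^ card X) = (-1 :: int)"
    using sum_Pow_neg1[OF fin(1) P] sum.remove[of "Pow P" "{}" "\<lambda>X. (-1::int) ^ card X"] fin by simp
  have one: "(\<Sum>X\<in>Pow P - {{}}. 1) = (2 ^ card P - 1 :: int)"
    using fin by (simp add: card_Diff_singleton card_Pow of_nat_diff)
  have sing: "(\<Sum>X\<in>Pow P - {{}}. of_bool (card X = 1)) = int (card P)"
  proof -
    have "{X \<in> Pow P - {{}}. card X = 1} = (\<lambda>x. {x}) ` P" by (auto simp: card_1_singleton_iff)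
    moreover have "card ((\<lambda>x. {x}) ` P) = card P" by (rule card_image) auto
    ultimately show ?thesis using fin by (simp add: Int_def)
  qed
  have "(\<Sum>X\<in>Pow P - {{}}. \<Sum>Y\<in>Pow Q. (-1::int) ^ (card (X \<union> Y) + r (X \<union> Y)))
    = (\<Sum>X\<in>Pow P - {{}}. \<Sum>Y\<in>Pow Q. (-1) ^ card X * (-1) ^ (card Y + f Y))"
    by (intro sum.cong refl) (auto simp: f card power_add)
  also have "\<dots> = - (\<Sum>Y\<in>Pow Q. (-1) ^ (card Y + f Y))"
    unfolding sum_product[symmetric] alt by simp
  finally show "acyc E r = (\<Sum>Y\<in>Pow Q. (-1) ^ (card Y + r Y)) - (\<Sum>Y\<in>Pow Q. (-1) ^ (card Y + f Y))"
    unfolding acyc_def split by simp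
  have "(\<Sum>X\<in>Pow P - {{}}. \<Sum>Y\<in>Pow Q. (-1::int) ^ (r E + r (X \<union> Y)))
    = (\<Sum>X\<in>Pow P - {{}}. \<Sum>Y\<in>Pow Q. 1 * (-1) ^ (f Q + f Y))"
    by (intro sum.cong refl) (auto simp: f fE)
  also have "\<dots> = (2 ^ card P - 1) * (\<Sum>Y\<in>Pow Q. (-1) ^ (f Q + f Y))"
    unfolding sum_product[symmetric] one by simp
  finally show "cyc E r = (\<Sum>Y\<in>Pow Q. (-1) ^ (f Q + r Y))
           + (2 ^ card P - 1) * (\<Sum>Y\<in>Pow Q. (-1) ^ (f Q + f Y))"
    unfolding cyc_def split by (simp add: fE)
  \<comment> \<open>A single element of P already attains \<open>f Y\<close>, so a basis cannot
    contain two elements of P.\<close>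
  have fle: "f Y \<le> Suc (card Y)" if "Y \<subseteq> Q" for Y
  proof -
    obtain p where "p \<in> P" using P by auto
    then show ?thesis
      using f[of "{p}" Y] rank_le_card[of "{p} \<union> Y"] card[of "{p}" Y] that E by auto
  qed
  have "(\<Sum>X\<in>Pow P - {{}}. \<Sum>Y\<in>Pow Q. of_bool (card (X \<union> Y) = r E \<and> r (X \<union> Y) = r E))
    = (\<Sum>X\<in>Pow P - {{}}. \<Sum>Y\<in>Pow Q. of_bool (card X = 1) * of_bool (Suc (card Y) = f Q \<and> f Y = f Q) :: int)"
  proof (intro sum.cong refl)
    fix X Y assume X: "X \<in> Pow P - {{}}" and Y: "Y \<in> Pow Q"
    have "card X > 0" using X fin by (auto simp: card_gt_0_iff intro: finite_subset)
    then show "of_bool (card (X \<union> Y) = r E \<and> r (X \<union> Y) = r E)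
      = (of_bool (card X = 1) * of_bool (Suc (card Y) = f Q \<and> f Y = f Q) :: int)"
      using X Y fle[of Y] f[of X Y] card[of X Y] fE by auto
  qed
  also have "\<dots> = int (card P) * (\<Sum>Y\<in>Pow Q. of_bool (Suc (card Y) = f Q \<and> f Y = f Q))"
    unfolding sum_product[symmetric] sing by simp
  finally show "nbases E r = (\<Sum>Y\<in>Pow Q. of_bool (card Y = f Q \<and> r Y = f Q))
           + int (card P) * (\<Sum>Y\<in>Pow Q. of_bool (Suc (card Y) = f Q \<and> f Y = f Q))"
    unfolding nbases_def split by (simp add: fE)
qed

lemma merino_welsh_rank_1:
  assumes ll: "loopless E r" and cl: "coloopless E r" and k: "r E = 1"
  shows "merino_welsh E r"
proof -
  have r1: "r X = 1" if "X \<subseteq> E" "X \<noteq> {}" for X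
    using rank_one_subset[OF ll that] rank_mono[of X E] that k by simp
  have ne: "E \<noteq> {}" using k rank_empty by auto
  \<comment> \<open>The whole ground set is the parallel class, with the empty set in the role of
    Q.\<close>
  have s: "E = E \<union> {}" "E \<inter> {} = {}" by auto
  note sums = sum_parallel_class[OF s ne, of "\<lambda>_. 1"]
  have "acyc E r = 2" "cyc E r = 2 ^ card E - 2" "nbases E r = int (card E)"
    by (subst sums; simp add: r1 rank_empty)+
  moreover have "2 \<le> card E"
  proof (rule ccontr)
    assume "\<not> 2 \<le> card E"
    moreover have "card E \<noteq> 0" using ne finite_E by simp
    ultimately obtain e where "E = {e}" by (metis One_nat_def Suc_1 card_1_singletonE less_2_cases not_less)
    then show False using cl k rank_empty unfolding coloopless_def by auto
  qed
  moreover from this have "(4::int) \<le> 2 ^ card E" using power_increasing[of 2 "card E" "2::int"] by simp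
  ultimately show ?thesis unfolding merino_welsh_def using square_le_exp[of "card E"] by simp
qed

text \<open>The two cases for \<open>r Q\<close> are a cycle with one edge replaced by the parallel class \<open>P\<close>, and the
  direct sum of the cycle \<open>Q\<close> and the parallel class \<open>P\<close>.\<close>

lemma merino_welsh_one_parallel_one_series:
  assumes E: "E = P \<union> Q" "P \<inter> Q = {}" and P: "P \<noteq> {}" and Q: "card Q = k" "0 < k"
    and f: "\<And>X Y. X \<subseteq> P \<Longrightarrow> X \<noteq> {} \<Longrightarrow> Y \<subseteq> Q \<Longrightarrow> r (X \<union> Y) = (if Y = Q then k else Suc (card Y))"
    and rY: "\<And>Y. Y \<subset> Q \<Longrightarrow> r Y = card Y"
    and rQ: "r Q = k \<or> r Q = k - 1 \<and> 2 \<le> k \<and> 2 \<le> card P"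
  shows "merino_welsh E r"
proof -
  have fin: "finite P" "finite Q" using finite_E E by auto
  define f where "f Y = (if Y = Q then k else Suc (card Y))" for Y
  have "\<forall>X\<in>Pow P - {{}}. \<forall>Y\<in>Pow Q. r (X \<union> Y) = f Y"
    using f unfolding f_def by simp
  note sums = sum_parallel_class[OF E P this]
  have fQ: "f Q = k" by (simp add: f_def)
  have Qne: "Q \<noteq> {}" using Q by auto
  have split: "(\<Sum>Y\<in>Pow Q. g Y) = g Q + (\<Sum>Y\<in>Pow Q - {Q}. g Y)" for g :: "'a set \<Rightarrow> int"
    by (rule sum.remove) (use fin in auto)
  have alt: "(\<Sum>Y\<in>Pow Q - {Q}. (-1) ^ card Y) = (- ((-1) ^ k) :: int)"
    using sum_Pow_neg1[OF fin(2) Qne] split[of "\<lambda>Y. (-1) ^ card Y"] Q by simp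
  have one: "(\<Sum>Y\<in>Pow Q - {Q}. 1) = (2 ^ k - 1 :: int)"
    using fin Q by (simp add: card_Diff_singleton card_Pow of_nat_diff)
  have s1: "(\<Sum>Y\<in>Pow Q - {Q}. (-1) ^ (card Y + f Y)) = (\<Sum>Y\<in>Pow Q - {Q}. -1 * 1 :: int)"
    by (rule sum.cong) (auto simp: f_def)
  have s2: "(\<Sum>Y\<in>Pow Q - {Q}. (-1) ^ (k + f Y)) = (\<Sum>Y\<in>Pow Q - {Q}. - ((-1) ^ k) * (-1) ^ card Y :: int)"
    by (rule sum.cong) (auto simp: f_def power_add)
  have s3: "(\<Sum>Y\<in>Pow Q - {Q}. (-1) ^ (card Y + r Y)) = (\<Sum>Y\<in>Pow Q - {Q}. 1 :: int)"
    by (rule sum.cong) (auto simp: rY psubset_eq)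
  have s4: "(\<Sum>Y\<in>Pow Q - {Q}. (-1) ^ (k + r Y)) = (\<Sum>Y\<in>Pow Q - {Q}. (-1) ^ k * (-1) ^ card Y :: int)"
    by (rule sum.cong) (auto simp: rY psubset_eq power_add)
  have cl: "card Y < k" if "Y \<in> Pow Q - {Q}" for Y
    using that Q fin by (auto intro: psubset_card_mono)
  have s5: "(\<Sum>Y\<in>Pow Q - {Q}. of_bool (card Y = k \<and> r Y = k)) = (0 :: int)"
    by (intro sum.neutral ballI) (use cl in \<open>simp add: less_imp_neq\<close>)
  \<comment> \<open>A basis using one element of P omits exactly one element of Q.\<close>
  have s6: "(\<Sum>Y\<in>Pow Q - {Q}. of_bool (Suc (card Y) = k \<and> f Y = k)) = int k"
  proof -
    have "{Y \<in> Pow Q - {Q}. Suc (card Y) = k \<and> f Y = k} = {Y. Y \<subseteq> Q \<and> card Y = k - 1}"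
      using Q by (auto simp: f_def)
    moreover have "card {Y. Y \<subseteq> Q \<and> card Y = k - 1} = k"
      using n_subsets[OF fin(2)] Q by (cases k) auto
    ultimately show ?thesis using fin by (simp add: Int_def)
  qed
  note s = s1[folded sum_distrib_left, unfolded one] s2[folded sum_distrib_left, unfolded alt]
    s3[unfolded one] s4[folded sum_distrib_left, unfolded alt] s5 s6
  have sq: "(-1) ^ k * (-1) ^ k = (1::int)" by (simp flip: power_mult_distrib)
  have m: "0 < card P" using P fin by (simp add: card_gt_0_iff)
  from rQ show ?thesis
  proof
    assume rQ: "r Q = k"
    have "acyc E r = 2 ^ Suc k - 2" "cyc E r = 2 ^ Suc (card P) - 2"
       "nbases E r = 1 + int (card P) * int k"
      unfolding sums split fQ s by (simp_all add: Q fQ rQ sq flip: power_add mult_2)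
    \<comment> \<open>The intermediate bound separates \<open>card P\<close> from k, so that
      \<open>oblong_le_exp\<close> applies to each factor. After writing both as successors, the
      difference is a polynomial with nonnegative coefficients.\<close>
    moreover have "(1 + int (card P) * int k)\<^sup>2 \<le> (int k * (int k + 1)) * (int (card P) * (int (card P) + 1))"
    proof -
      obtain a b where "int k = a + 1" "int (card P) = b + 1" "0 \<le> a" "0 \<le> b"
        using m Q by (metis add.commute of_nat_0_le_iff of_nat_Suc gr0_implies_Suc)
      then show ?thesis by (simp add: power2_eq_square algebra_simps)
    qed
    moreover have "\<dots> \<le> (2 ^ Suc k - 2) * (2 ^ Suc (card P) - 2)"
      by (intro mult_mono oblong_le_exp) (simp_all add: one_le_power)
    ultimately show ?thesis unfolding merino_welsh_def by (simp add: one_le_power)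
  next
    assume rQ: "r Q = k - 1 \<and> 2 \<le> k \<and> 2 \<le> card P"
    then obtain j where j: "k = Suc j" by (cases k) auto
    have "acyc E r = 2 * (2 ^ k - 2)" "cyc E r = 2 * (2 ^ card P - 2)"
       "nbases E r = int (card P) * int k"
      unfolding sums split fQ s using rQ j by (simp_all add: Q fQ sq flip: power_add mult_2)
    moreover have p: "(2::int) \<le> 2 ^ k" "(2::int) \<le> 2 ^ card P"
      using power_increasing[of 1 k "2::int"] power_increasing[of 1 "card P" "2::int"] Q m by simp_all
    moreover have "(int (card P) * int k)\<^sup>2 \<le> (2 * (2 ^ k - 2)) * (2 * (2 ^ card P - 2))"
      unfolding power_mult_distrib using rQ p
      by (subst mult.commute, intro mult_mono square_le_exp) auto
    ultimately show ?thesis unfolding merino_welsh_def by simp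
  qed
qed

text \<open>X spans P, so either may replace the other inside a union. This is how one member of a
  parallel class stands for the whole class.\<close>

lemma rank_Un_cong:
  assumes "X \<subseteq> P" "P \<subseteq> E" "Y \<subseteq> E" "r X = r P"
  shows "r (X \<union> Y) = r (P \<union> Y)"
proof (rule antisym)
  show "r (X \<union> Y) \<le> r (P \<union> Y)" using assms by (intro rank_mono) auto
  have "r (P \<union> (X \<union> Y)) + r (P \<inter> (X \<union> Y)) \<le> r P + r (X \<union> Y)"
    using assms by (intro rank_submod) auto
  moreover have "P \<union> (X \<union> Y) = P \<union> Y" using assms by auto
  moreover have "r X \<le> r (P \<inter> (X \<union> Y))" using assms by (intro rank_mono) auto
  ultimately show "r (P \<union> Y) \<le> r (X \<union> Y)" using assms by simp
qed

text \<open>The sums involving \<open>r Y\<close> stay unevaluated because the two uses differ: a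
  set Q of rank 1 is a second parallel class, while for Q of rank 2 they are the invariants of Q
  itself.\<close>

lemma sum_parallel_class_rank_2:
  assumes E: "E = P \<union> Q" "P \<inter> Q = {}" and P: "P \<noteq> {}" and Q: "Q \<noteq> {}"
    and f: "\<forall>X\<in>Pow P - {{}}. \<forall>Y\<in>Pow Q. r (X \<union> Y) = (if Y = {} then 1 else 2)"
  shows "acyc E r = (\<Sum>Y\<in>Pow Q. (-1) ^ (card Y + r Y)) + 2"
    and "cyc E r = (\<Sum>Y\<in>Pow Q. (-1) ^ (2 + r Y)) + (2 ^ card P - 1) * (2 ^ card Q - 2)"
    and "nbases E r = (\<Sum>Y\<in>Pow Q. of_bool (card Y = 2 \<and> r Y = 2)) + int (card P) * int (card Q)"
proof -
  define f where "f Y = (if Y = {} then 1 else 2::nat)" for Y :: "'a set"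
  note sums = sum_parallel_class[OF E P f, folded f_def]
  have fQ: "f Q = 2" using Q by (simp add: f_def)
  have "finite Q" using E finite_E by auto
  note s = sum_Pow_case_empty[OF this Q, folded f_def]
  show "acyc E r = (\<Sum>Y\<in>Pow Q. (-1) ^ (card Y + r Y)) + 2"
    "cyc E r = (\<Sum>Y\<in>Pow Q. (-1) ^ (2 + r Y)) + (2 ^ card P - 1) * (2 ^ card Q - 2)"
    "nbases E r = (\<Sum>Y\<in>Pow Q. of_bool (card Y = 2 \<and> r Y = 2)) + int (card P) * int (card Q)"
    unfolding sums fQ s by simp_all
qed

text \<open>This is a direct sum of two uniform matroids of rank 1, so the inequality is the product
  of two instances of \<open>square_le_exp\<close>.\<close>

lemma merino_welsh_two_parallel_classes:
  assumes ll: "loopless E r" and E: "E = P \<union> Q" "P \<inter> Q = {}" "r E = 2"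
    and P: "r P = 1" "2 \<le> card P" and Q: "r Q = 1" "2 \<le> card Q"
  shows "merino_welsh E r"
proof -
  have PE: "P \<subseteq> E" and QE: "Q \<subseteq> E" using E by auto
  have ne: "P \<noteq> {}" "Q \<noteq> {}" using P Q by auto
  have rX: "r X = 1" if "X \<subseteq> P" "X \<noteq> {}" for X
    using rank_one_subset[OF ll _ that(2)] rank_mono[OF that(1) PE] that(1) PE P by auto
  have rY: "r Y = (if Y = {} then 0 else 1)" if "Y \<subseteq> Q" for Y
    using rank_one_subset[OF ll, of Y] rank_mono[OF that(1) QE] that(1) QE Q rank_empty by auto
  have f: "r (X \<union> Y) = (if Y = {} then 1 else 2)" if "X \<subseteq> P" "X \<noteq> {}" "Y \<subseteq> Q" for X Y
  proof (cases "Y = {}")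
    case False
    have "r (X \<union> Y) = r (P \<union> Y)"
      by (rule rank_Un_cong) (use that PE QE rX P in auto)
    also have "\<dots> = r (Y \<union> P)" by (simp add: Un_commute)
    also have "\<dots> = r (Q \<union> P)"
      by (rule rank_Un_cong) (use that PE QE rY False Q in auto)
    also have "\<dots> = 2" using E by (simp add: Un_commute)
    finally show ?thesis using False by simp
  qed (use rX that in auto)
  have "\<forall>X\<in>Pow P - {{}}. \<forall>Y\<in>Pow Q. r (X \<union> Y) = (if Y = {} then 1 else 2)"
    using f by simp
  note sums = sum_parallel_class_rank_2[OF E(1,2) ne this]
  have fQ: "finite Q" using QE finite_sub by auto
  have "(\<Sum>Y\<in>Pow Q. (-1::int) ^ (card Y + r Y)) = (\<Sum>Y\<in>Pow Q. (-1) ^ (card Y + (if Y = {} then 0 else 1)))"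
    by (rule sum.cong) (auto simp: rY)
  also have "\<dots> = 2" by (rule sum_Pow_case_empty(4)[OF fQ ne(2)])
  finally have a: "acyc E r = 4" using sums(1) by simp
  have "(\<Sum>Y\<in>Pow Q. (-1::int) ^ (2 + r Y)) = (\<Sum>Y\<in>Pow Q. (-1) ^ (2 + (if Y = {} then 0 else 1)))"
    by (rule sum.cong) (auto simp: rY)
  also have "\<dots> = 2 - 2 ^ card Q" by (rule sum_Pow_case_empty(5)[OF fQ ne(2)])
  finally have b: "cyc E r = (2 ^ card P - 2) * (2 ^ card Q - 2)" using sums(2) by (simp add: algebra_simps)
  have "(\<Sum>Y\<in>Pow Q. of_bool (card Y = 2 \<and> r Y = 2)) = (0::int)"
    by (rule sum.neutral) (auto simp: rY)
  then have t: "nbases E r = int (card P) * int (card Q)" using sums(3) by simp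
  have p: "(2::int) \<le> 2 ^ card P" "(2::int) \<le> 2 ^ card Q"
    using power_increasing[of 1 "card P" "2::int"] power_increasing[of 1 "card Q" "2::int"] P Q by simp_all
  have "(int (card P) * int (card Q))\<^sup>2 \<le> (2 * (2 ^ card P - 2)) * (2 * (2 ^ card Q - 2))"
    unfolding power_mult_distrib
    by (intro mult_mono square_le_exp) (use p P Q in auto)
  also have "\<dots> = 4 * ((2 ^ card P - 2) * (2 ^ card Q - 2))" by (simp add: algebra_simps)
  finally show ?thesis using p unfolding merino_welsh_def a b t by simp
qed

text \<open>The contraction of \<open>P\<close> is uniform of rank 1 on at least 3 elements, where the inequality has a
  slack of \<open>4 / 3\<close>; this absorbs the failure of \<open>card P ^ 2 \<le> 2 ^ card P - 1\<close> for small \<open>P\<close>.\<close>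

lemma merino_welsh_add_parallel_class_rank_2:
  assumes ll: "loopless E r" and E: "E = P \<union> Q" "P \<inter> Q = {}" "r E = 2"
    and P: "r P = 1" and Q: "r Q = 2" "3 \<le> card Q" "merino_welsh Q r"
    and PQ: "\<And>x y. x \<in> P \<Longrightarrow> y \<in> Q \<Longrightarrow> r {x, y} = 2"
  shows "merino_welsh E r"
proof -
  have PE: "P \<subseteq> E" and QE: "Q \<subseteq> E" using E by auto
  have ne: "P \<noteq> {}" "Q \<noteq> {}" using P Q rank_empty by auto
  have f: "r (X \<union> Y) = (if Y = {} then 1 else 2)" if "X \<subseteq> P" "X \<noteq> {}" "Y \<subseteq> Q" for X Y
  proof (cases "Y = {}")
    case True
    then show ?thesis using rank_one_subset[OF ll _ that(2)] rank_mono[OF that(1) PE] that(1) PE P by auto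
  next
    case False
    then obtain x y where "x \<in> X" "y \<in> Y" using \<open>X \<noteq> {}\<close> by blast
    moreover from this have "r {x, y} = 2" using PQ that by blast
    moreover have XYE: "X \<union> Y \<subseteq> E" using that PE QE by blast
    ultimately have "2 \<le> r (X \<union> Y)" using rank_mono[of "{x, y}" "X \<union> Y"] by simp
    moreover have "r (X \<union> Y) \<le> 2" using rank_mono[OF XYE order_refl] E(3) by simp
    ultimately show ?thesis using False by simp
  qed
  have "\<forall>X\<in>Pow P - {{}}. \<forall>Y\<in>Pow Q. r (X \<union> Y) = (if Y = {} then 1 else 2)"
    using f by simp
  note sums = sum_parallel_class_rank_2[OF E(1,2) ne this]
  let ?a = "int (card P)" and ?q = "int (card Q)"
  have m: "(3 * ?a\<^sup>2) * (4 * ?q\<^sup>2) \<le> (4 * (2 ^ card P - 1)) * (3 * (2 * (2 ^ card Q - 2)))"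
    by (intro mult_mono square_le_exp_3_4 square_le_exp_4_3) (auto simp: Q)
  have p: "(2::int) \<le> 2 ^ card Q" "(1::int) \<le> 2 ^ card P"
    using power_increasing[of 1 "card Q" "2::int"] Q by simp_all
  \<comment> \<open>Subsets disjoint from P contribute the invariants of Q, the others a second
    triple that satisfies its own inequality \<open>m2\<close>; \<open>cauchy_schwarz_step\<close>
    adds the two.\<close>
  have sums': "acyc E r = acyc Q r + 2" "cyc E r = cyc Q r + (2 ^ card P - 1) * (2 ^ card Q - 2)"
    "nbases E r = nbases Q r + ?a * ?q"
    using sums unfolding acyc_def cyc_def nbases_def Q by simp_all
  have m2: "(?a * ?q)\<^sup>2 \<le> 2 * ((2 ^ card P - 1) * (2 ^ card Q - 2))"
  proof -
    have "(4 * (u - 1)) * (3 * (2 * (v - 2))) = 12 * (2 * ((u - 1) * (v - 2)))" for u v :: int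
      by (simp add: algebra_simps)
    then show ?thesis using m unfolding power_mult_distrib by simp
  qed
  have "0 \<le> (2 ^ card P - 1) * (2 ^ card Q - 2 :: int)" using p by simp
  then show ?thesis
    using Q(3) m2 unfolding merino_welsh_def sums' by (auto intro!: cauchy_schwarz_step add_nonneg_nonneg)
qed

section \<open>Irreducible matroids\<close>

lemma parallel_unique:
  assumes ll: "loopless E r" and es: "elementary_split E r" and k: "3 \<le> r E"
    and "e \<in> E" "f \<in> E" "e \<noteq> f" "r {e, f} = 1" "a \<in> E" "b \<in> E" "a \<noteq> b" "r {a, b} = 1"
  shows "r {e, a} = 1"
proof (rule ccontr)
  \<comment> \<open>If e and a were not parallel, contracting e would make f a loop and keep a and b
    parallel. Rank 3 provides an element c outside the span of a, b and e, which supplies the coloop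
    of the excluded minor.\<close>
  assume "r {e, a} \<noteq> 1"
  moreover have "r {e, a} \<le> 2" using rank_insert_le[of "{a}" e] assms unfolding loopless_def by simp
  moreover have "r {e, a} \<ge> 1" using rank_insert_ge[of "{a}" e] assms unfolding loopless_def by simp
  ultimately have ea: "r {e, a} = 2" by linarith
  have 1: "r {e} = 1" "r {a} = 1" "r {b} = 1" using ll assms unfolding loopless_def by auto
  have abe: "r {a, b, e} = 2"
    using rank_Un_cong[of "{a}" "{a, b}" "{e}"] assms 1 ea by (simp add: insert_commute)
  have be: "r {b, e} = 2"
    using rank_Un_cong[of "{b}" "{a, b}" "{e}"] assms 1 abe by (simp add: insert_commute)
  have abeE: "{a, b, e} \<subseteq> E" using assms by simp
  have "\<exists>c\<in>E. r (insert c {a, b, e}) \<noteq> 2"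
  proof (rule ccontr)
    assume "\<not> ?thesis"
    then have "r ({a, b, e} \<union> E) = r {a, b, e}"
      using abe by (intro rank_absorb[OF abeE order_refl]) auto
    then show False using k abe abeE by (simp only: Un_absorb1)
  qed
  then obtain c where c: "c \<in> E" "r (insert c {a, b, e}) \<noteq> 2" by blast
  then have abec: "r (insert c {a, b, e}) = 3"
    using rank_insert_le[of "{a, b, e}" c] rank_insert_ge[of "{a, b, e}" c] abe assms by simp
  have "a \<noteq> e" using ea 1 by auto
  moreover have "b \<noteq> e" using be 1 by auto
  moreover have "c \<noteq> e" using c(2) abe by (auto simp: insert_absorb)
  ultimately have "{e} \<subseteq> E" "{f, a, b, c} \<subseteq> E - {e}" using assms c by auto
  moreover have "r (insert f {e}) = r {e}" "r (insert a {e}) = Suc (r {e})"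
    "r (insert b {e}) = Suc (r {e})" "r (insert a (insert b {e})) = Suc (r {e})"
    "r (insert c (insert a (insert b {e}))) = Suc (Suc (r {e}))"
    using \<open>r {e, f} = 1\<close> 1 ea be abe abec by (simp_all add: insert_commute)
  ultimately show False using elementary_splitD[OF es _ _ \<open>a \<noteq> b\<close>, of "{e}" f c] by blast
qed

text \<open>By \<open>parallel_unique\<close>, any element with a parallel partner is parallel to
  every other such element, hence spans all of them.\<close>

lemma rank_parallel_elements:
  assumes ll: "loopless E r" and es: "elementary_split E r" and k: "3 \<le> r E"
  shows "r {e \<in> E. \<exists>f\<in>E - {e}. r {e, f} = 1} \<le> 1"
proof (cases "{e \<in> E. \<exists>f\<in>E - {e}. r {e, f} = 1} = {}")
  case False
  then obtain e f where e: "e \<in> E" "f \<in> E" "e \<noteq> f" "r {e, f} = 1" by auto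
  let ?P = "{e \<in> E. \<exists>f\<in>E - {e}. r {e, f} = 1}"
  have "r ({e} \<union> ?P) = r {e}"
  proof (rule rank_absorb)
    fix p assume "p \<in> ?P"
    then have "r {e, p} = 1" using parallel_unique[OF assms e] by blast
    then show "r (insert p {e}) = r {e}" using ll e unfolding loopless_def by (simp add: insert_commute)
  qed (use e in auto)
  moreover have "r ?P \<le> r ({e} \<union> ?P)" using e by (intro rank_mono) auto
  ultimately show ?thesis using ll e unfolding loopless_def by simp
qed (simp only: rank_empty)

text \<open>An element without a parallel partner has a series partner, that is, a parallel partner
  in the dual. With \<open>rank_parallel_elements\<close> on both sides, P has rank at most 1 and Q
  dual rank at most 1. This determines the ranks needed for the explicit computation.\<close>

lemma merino_welsh_irreducible_rank_ge_3:
  assumes ll: "loopless E r" and cl: "coloopless E r" and es: "elementary_split E r"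
    and k: "3 \<le> r E" "3 + r E \<le> card E"
    and irr: "\<And>e. e \<in> E \<Longrightarrow> \<exists>f\<in>E - {e}. r {e, f} = 1 \<or> r (E - {e, f}) < r E"
  shows "merino_welsh E r"
proof -
  let ?d = "dual_rank E r"
  interpret d: rank_function E ?d by (rule rank_function_dual)
  define P where "P = {e \<in> E. \<exists>f\<in>E - {e}. r {e, f} = 1}"
  define Q where "Q = E - P"
  have E: "E = P \<union> Q" "P \<inter> Q = {}" and PE: "P \<subseteq> E" and QE: "Q \<subseteq> E" and EQ: "E - Q = P"
    unfolding P_def Q_def by auto
  note dll = loopless_dual[OF cl]
  have rP: "r P \<le> 1" unfolding P_def by (rule rank_parallel_elements[OF ll es k(1)])
  have "Q \<subseteq> {e \<in> E. \<exists>f\<in>E - {e}. ?d {e, f} = 1}"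
  proof
    fix e assume e: "e \<in> Q"
    then obtain f where f: "f \<in> E" "f \<noteq> e" "r (E - {e, f}) < r E"
      using irr[of e] unfolding Q_def P_def by blast
    then have "?d {e, f} < 2" "e \<in> E" using dual_rank_eq[of "{e, f}"] e QE by auto
    moreover have "?d {e, f} \<ge> 1"
      using d.rank_insert_ge[of "{f}" e] dll f \<open>e \<in> E\<close> unfolding loopless_def by auto
    ultimately show "e \<in> {e \<in> E. \<exists>f\<in>E - {e}. ?d {e, f} = 1}" using f by force
  qed
  then have "?d Q \<le> ?d {e \<in> E. \<exists>f\<in>E - {e}. ?d {e, f} = 1}"
    by (rule d.rank_mono) auto
  also have "\<dots> \<le> 1"
    using dual_rank_E k
    by (intro d.rank_parallel_elements[OF dll elementary_split_dual[OF es]]) simp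
  finally have dQ: "?d Q \<le> 1" .
  have dZ: "?d Z = 1" if "Z \<subseteq> Q" "Z \<noteq> {}" for Z
    using d.rank_one_subset[OF dll _ that(2)] d.rank_mono[OF that(1) QE] dQ that QE by auto
  have Qne: "Q \<noteq> {}"
  proof
    assume "Q = {}"
    then have "P = E" using E(1) by blast
    then show False using rP k by simp
  qed
  \<comment> \<open>\<open>r P\<close> is kept as it is, since P has not yet been shown to be
    nonempty.\<close>
  have cQ: "card Q + r P = r E + 1"
    using dZ[OF order_refl Qne] dual_rank_eq[OF QE] unfolding EQ by simp
  have Pne: "P \<noteq> {}"
  proof
    assume "P = {}"
    then have "Q = E" unfolding Q_def by blast
    then show False using cQ k \<open>P = {}\<close> rank_empty by simp
  qed
  have rX: "r X = 1" if "X \<subseteq> P" "X \<noteq> {}" for X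
    using rank_one_subset[OF ll _ that(2)] rank_mono[OF that(1) PE] rP that PE by auto
  have cQ: "card Q = r E" using cQ rX[OF order_refl Pne] by simp
  have fQ: "finite Q" and fP: "finite P" using QE PE finite_sub by auto
  \<comment> \<open>The complement of \<open>P \<union> Y\<close> is the nonempty part
    \<open>Q - Y\<close> of a dual parallel class, whose dual rank is 1.\<close>
  have PY: "r (P \<union> Y) = Suc (card Y)" if "Y \<subset> Q" for Y
  proof -
    have "E - (Q - Y) = P \<union> Y" using that PE QE unfolding Q_def by blast
    then have "1 + r E = card (Q - Y) + r (P \<union> Y)"
      using dual_rank_eq[of "Q - Y"] dZ[of "Q - Y"] that QE by auto
    moreover have "card (Q - Y) + card Y = card Q"
      using card_Diff_subset[of Y Q] card_mono[of Q Y] finite_subset[of Y Q] that fQ by auto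
    ultimately show ?thesis using cQ by simp
  qed
  have f: "r (X \<union> Y) = (if Y = Q then r E else Suc (card Y))"
    if "X \<subseteq> P" "X \<noteq> {}" "Y \<subseteq> Q" for X Y
  proof -
    have "r (X \<union> Y) = r (P \<union> Y)"
      by (rule rank_Un_cong) (use that PE QE rX Pne in auto)
    moreover have "P \<union> Q = E" using E(1) by blast
    ultimately show ?thesis using PY[of Y] that(3) by (cases "Y = Q") auto
  qed
  have rY: "r Y = card Y" if "Y \<subset> Q" for Y
  proof -
    have "Y \<subseteq> E" using that QE by auto
    then show ?thesis using PY[OF that] rank_Un_le[of P Y] rank_le_card[of Y] rP PE by simp
  qed
  have "card P + card Q = card E" using card_Un_disjoint[OF fP fQ E(2)] unfolding E(1)[symmetric] by simp
  then have cP: "2 \<le> card P" using cQ k by simp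
  have "r E \<le> r Q + 1" using rank_Un_le[OF PE QE] rP unfolding E(1)[symmetric] by simp
  moreover have "r Q \<le> r E" using QE rank_mono by simp
  ultimately have rQ: "r Q = r E \<or> r Q = r E - 1 \<and> 2 \<le> r E \<and> 2 \<le> card P"
    using k cP by linarith
  have "0 < r E" using k by linarith
  then show ?thesis by (rule merino_welsh_one_parallel_one_series[OF E Pne cQ _ f rY rQ])
qed

text \<open>With many parallel classes around, contracting a single element would turn its partners
  into loops. Removing a full class P avoids this: the other elements keep parallel partners outside
  P, so if they have rank 2 they form a coloopless matroid to which induction applies.\<close>

lemma merino_welsh_irreducible_rank_2:
  assumes ll: "loopless E r" and cl: "coloopless E r" and k: "r E = 2" "4 \<le> card E"
    and irr: "\<And>e. e \<in> E \<Longrightarrow> \<exists>f\<in>E - {e}. r {e, f} = 1 \<or> r (E - {e, f}) < r E"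
    and IH: "\<And>Q. Q \<subset> E \<Longrightarrow> coloopless Q r \<Longrightarrow> merino_welsh Q r"
  shows "merino_welsh E r"
proof (cases "\<exists>e f. e \<in> E \<and> f \<in> E \<and> e \<noteq> f \<and> r (E - {e, f}) < r E")
  case True
  then obtain e f where ef: "e \<in> E" "f \<in> E" "e \<noteq> f" "r (E - {e, f}) < 2" using k by auto
  \<comment> \<open>P has rank 1, so only two shapes remain: \<open>{e, f}\<close> is a second
    parallel class, or P and \<open>{e, f}\<close> are one parallel class and one series
    pair.\<close>
  define P where "P = E - {e, f}"
  have E: "E = P \<union> {e, f}" "P \<inter> {e, f} = {}" and PE: "P \<subseteq> E"
    using ef unfolding P_def by auto
  have 1: "r {e} = 1" "r {f} = 1" using ll ef unfolding loopless_def by auto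
  have Pe: "r (P \<union> {e}) = 2" "r (P \<union> {f}) = 2"
  proof -
    have "E - {f} = P \<union> {e}" "E - {e} = P \<union> {f}" using ef unfolding P_def by auto
    then show "r (P \<union> {e}) = 2" "r (P \<union> {f}) = 2" using cl ef k unfolding coloopless_def by metis+
  qed
  have "r P \<le> 1" using ef(4) unfolding P_def by simp
  moreover have cP: "2 \<le> card P" using ef k finite_E unfolding P_def by (simp add: card_Diff_subset)
  ultimately have rX: "r X = 1" if "X \<subseteq> P" "X \<noteq> {}" for X
    using rank_one_subset[OF ll _ that(2)] rank_mono[OF that(1) PE] that PE by auto
  have Pne: "P \<noteq> {}" using cP by auto
  have "r {e, f} \<le> 2" using rank_le_card[of "{e, f}"] ef by auto
  moreover have "r {e, f} \<ge> 1" using rank_insert_ge[of "{f}" e] ef 1 by auto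
  ultimately consider "r {e, f} = 1" | "r {e, f} = 2" by linarith
  then show ?thesis
  proof cases
    case 1
    show ?thesis
      by (rule merino_welsh_two_parallel_classes[OF ll E k(1) rX[OF order_refl Pne] cP 1])
         (use ef in auto)
  next
    case 2
    show ?thesis
    proof (rule merino_welsh_one_parallel_one_series[OF E Pne, where k = 2])
      fix X Y assume XY: "X \<subseteq> P" "X \<noteq> {}" "Y \<subseteq> {e, f}"
      have "r (X \<union> Y) = r (P \<union> Y)"
        by (rule rank_Un_cong) (use XY PE ef rX Pne in auto)
      moreover have "Y = {} \<or> Y = {e} \<or> Y = {f} \<or> Y = {e, f}" using XY by blast
      ultimately show "r (X \<union> Y) = (if Y = {e, f} then 2 else Suc (card Y))"
        using Pe rX[OF order_refl Pne] E(1) k ef by auto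
    next
      fix Y assume "Y \<subset> {e, f}"
      then have "Y = {} \<or> Y = {e} \<or> Y = {f}" by blast
      then show "r Y = card Y" using 1 \<open>r {e} = 1\<close> \<open>r {f} = 1\<close> rank_empty by auto
    qed (use ef 2 in auto)
  qed
next
  case False
  have par: "\<exists>f\<in>E - {e}. r {e, f} = 1" if "e \<in> E" for e
    using irr[OF that] False that by blast
  obtain e where e: "e \<in> E" using k by force
  define P where "P = {f \<in> E. r {e, f} = 1}"
  define Q where "Q = E - P"
  have E: "E = P \<union> Q" "P \<inter> Q = {}" and PE: "P \<subseteq> E" and QE: "Q \<subseteq> E"
    unfolding P_def Q_def by auto
  have 1: "r {x} = 1" if "x \<in> E" for x using ll that unfolding loopless_def by auto
  have eP: "e \<in> P" using e 1 unfolding P_def by simp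
  have "r ({e} \<union> P) = r {e}"
    by (rule rank_absorb) (use e 1 in \<open>auto simp: P_def insert_commute\<close>)
  then have rP: "r P = 1" using eP 1 e by (simp add: insert_absorb)
  have PQ: "r {x, y} = 2" if x: "x \<in> P" and y: "y \<in> Q" for x y
  proof -
    have "r ({x} \<union> {y}) = r (P \<union> {y})" "r ({e} \<union> {y}) = r (P \<union> {y})"
      by (rule rank_Un_cong; use x y eP PE QE rP 1 in auto)+
    moreover have "r {e, y} \<noteq> 1" using y unfolding P_def Q_def by auto
    moreover have "r {e, y} \<le> 2" using rank_insert_le[of "{y}" e] y QE e 1 by auto
    moreover have "r {e, y} \<ge> 1" using rank_insert_ge[of "{y}" e] y QE e 1 by auto
    ultimately show ?thesis by (simp add: insert_commute)
  qed
  have Qpar: "\<exists>g\<in>Q - {q}. r {q, g} = 1" if "q \<in> Q" for q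
  proof -
    obtain g where g: "g \<in> E - {q}" "r {q, g} = 1" using par \<open>q \<in> Q\<close> QE by blast
    moreover have "g \<notin> P"
    proof
      assume "g \<in> P"
      then have "r {g, q} = 2" using PQ that by blast
      then show False using g(2) by (simp add: insert_commute)
    qed
    ultimately show ?thesis unfolding Q_def by blast
  qed
  have "Q \<noteq> {}"
  proof
    assume "Q = {}"
    then have "P = E" using E(1) by blast
    then show False using rP k by simp
  qed
  then obtain q where q: "q \<in> Q" by auto
  have fin: "finite P" "finite Q" using PE QE finite_sub by auto
  have two: "2 \<le> card A" if "finite A" "x \<in> A" "y \<in> A" "x \<noteq> y" for A and x y :: 'a
    using card_mono[of A "{x, y}"] that by auto
  have "r Q \<le> 2" using rank_mono[of Q E] QE k by simp
  moreover have "1 \<le> r Q" using rank_mono[of "{q}" Q] QE q 1[of q] by auto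
  ultimately consider "r Q = 1" | "r Q = 2" by linarith
  then show ?thesis
  proof cases
    case 1
    obtain p where "p \<in> P" "p \<noteq> e" using par[OF e] unfolding P_def by auto
    then have "2 \<le> card P" using two[OF fin(1) _ eP] by blast
    moreover have "2 \<le> card Q" using Qpar[OF q] two[OF fin(2) _ q] by blast
    ultimately show ?thesis
      using merino_welsh_two_parallel_classes[OF ll E k(1) rP _ 1] by simp
  next
    case 2
    have Qcl: "coloopless Q r"
      unfolding coloopless_def
    proof
      fix q assume q: "q \<in> Q"
      then obtain g where g: "g \<in> Q - {q}" "r {q, g} = 1" using Qpar by blast
      have "r (insert q (Q - {q})) = r (Q - {q})"
        by (rule rank_insert_mono[of "{g}"]) (use g q QE \<open>\<And>x. x \<in> E \<Longrightarrow> r {x} = 1\<close> in auto)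
      then show "r (Q - {q}) = r Q" using q by (simp add: insert_absorb)
    qed
    \<comment> \<open>Without q the rank is still 2, so at least two further elements remain; this
      gives the 3 that \<open>square_le_exp_4_3\<close> requires.\<close>
    have "2 \<le> card (Q - {q})"
      using Qcl q 2 rank_le_card[of "Q - {q}"] QE unfolding coloopless_def by auto
    then have "3 \<le> card Q" using q fin by simp
    moreover have "Q \<subset> E" using eP E by blast
    ultimately show ?thesis
      by (intro merino_welsh_add_parallel_class_rank_2[OF ll E k(1) rP 2 _ IH[OF _ Qcl] PQ])
  qed
qed

section \<open>The induction\<close>

lemma merino_welsh_step:
  assumes ll: "loopless E r" and cl: "coloopless E r" and es: "elementary_split E r"
    and k: "2 * r E \<le> card E"
    and IH: "\<And>(E'::'a set) r'. card E' < card E \<Longrightarrow> rank_function E' r' \<Longrightarrow> loopless E' r' \<Longrightarrow>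
      coloopless E' r' \<Longrightarrow> elementary_split E' r' \<Longrightarrow> merino_welsh E' r'"
  shows "merino_welsh E r"
proof -
  have IHsub: "merino_welsh Q r" if "Q \<subset> E" "coloopless Q r" for Q
    by (rule IH) (use that ll es finite_E in \<open>auto simp: psubset_card_mono loopless_def
      intro: rank_function_subset elementary_split_subset\<close>)
  \<comment> \<open>An element e violating this has no parallel partner, so contracting it creates
    no loop, and no series partner, so deleting it creates no coloop: both minors are then within
    reach of the induction hypothesis.\<close>
  let ?irr = "\<forall>e\<in>E. \<exists>f\<in>E - {e}. r {e, f} = 1 \<or> r (E - {e, f}) < r E"
  consider "r E = 0" | "r E = 1" | "\<not> ?irr" | "r E = 2" ?irr | "3 \<le> r E" ?irr
    by linarith
  then show ?thesis
  proof cases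
    case 1
    have "E = {}"
    proof (rule ccontr)
      assume "E \<noteq> {}"
      then obtain e where "e \<in> E" by auto
      then show False using ll rank_mono[of "{e}" E] 1 unfolding loopless_def by auto
    qed
    then show ?thesis by (simp add: merino_welsh_def acyc_def cyc_def nbases_def rank_empty)
  next
    case 2
    then show ?thesis using merino_welsh_rank_1 ll cl by blast
  next
    case 3
    then obtain e where e: "e \<in> E"
      and n: "\<And>f. f \<in> E - {e} \<Longrightarrow> r {e, f} \<noteq> 1 \<and> \<not> r (E - {e, f}) < r E" by blast
    have re: "r {e} = 1" and rE: "r (E - {e}) = r E"
      using ll cl e unfolding loopless_def coloopless_def by auto
    show ?thesis
    proof (rule merino_welsh_deletion_contraction[OF e re rE])
      show "merino_welsh (E - {e}) r"
      proof (rule IHsub)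
        show "coloopless (E - {e}) r"
          unfolding coloopless_def
        proof
          fix f assume f: "f \<in> E - {e}"
          have "r (E - {e, f}) \<le> r E" by (rule rank_mono) auto
          moreover have "E - {e} - {f} = E - {e, f}" by auto
          ultimately show "r (E - {e} - {f}) = r (E - {e})" using n[OF f] rE by simp
        qed
      qed (use e in auto)
      show "merino_welsh (E - {e}) (contraction r e)"
      proof (rule IH)
        show "card (E - {e}) < card E" using e finite_E by (intro card_Diff1_less)
        show "rank_function (E - {e}) (contraction r e)" by (rule rank_function_contraction[OF e])
        show "elementary_split (E - {e}) (contraction r e)"
          by (rule elementary_split_contraction[OF e es])
        show "loopless (E - {e}) (contraction r e)"
          unfolding loopless_def
        proof
          fix f assume f: "f \<in> E - {e}"
          have "r {e, f} \<le> 2" "1 \<le> r {e, f}"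
            using rank_insert_le[of "{f}" e] rank_insert_ge[of "{f}" e] f e ll
            unfolding loopless_def by auto
          then show "contraction r e {f} = 1"
            using n[OF f] re unfolding contraction_def by auto
        qed
        show "coloopless (E - {e}) (contraction r e)"
          unfolding coloopless_def contraction_def
        proof
          fix f assume f: "f \<in> E - {e}"
          have "insert e (E - {e} - {f}) = E - {f}" "insert e (E - {e}) = E" using f e by auto
          then show "r (insert e (E - {e} - {f})) - r {e} = r (insert e (E - {e})) - r {e}"
            using cl f unfolding coloopless_def by simp
        qed
      qed
    qed
  next
    case 4
    show ?thesis
      by (rule merino_welsh_irreducible_rank_2[OF ll cl 4(1)]) (use k 4 IHsub in auto)
  next
    case 5
    show ?thesis
      by (rule merino_welsh_irreducible_rank_ge_3[OF ll cl es 5(1)]) (use k 5 in auto)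
  qed
qed

end

text \<open>The dual lives on the same ground set and satisfies the same hypotheses, so the
  induction hypothesis serves both; one of the two has rank at most half of
  \<open>card E\<close>.\<close>

lemma merino_welsh_elementary_split:
  assumes "rank_function E r" "loopless E r" "coloopless E r" "elementary_split E r"
  shows "merino_welsh E r"
  using assms
proof (induction "card E" arbitrary: E r rule: less_induct)
  case less
  interpret rank_function E r by fact
  interpret d: rank_function E "dual_rank E r" by (rule rank_function_dual)
  show ?case
  proof (cases "2 * r E \<le> card E")
    case True
    then show ?thesis using merino_welsh_step less by blast
  next
    case False
    then have "2 * dual_rank E r E \<le> card E" using dual_rank_E by simp
    then have "merino_welsh E (dual_rank E r)"
      using d.merino_welsh_step less loopless_dual coloopless_dual elementary_split_dual by blast
    then show ?thesis using merino_welsh_dual by simp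
  qed
qed

section \<open>Matroids as rank functions\<close>

context matroid
begin

lemma finite_indep: "X \<in> indep M \<Longrightarrow> finite X"
  using indep_subset_ground finite_ground finite_subset by blast

lemma finite_card_indep: "finite (card ` {X \<in> indep M. X \<subseteq> A})"
proof -
  have "{X \<in> indep M. X \<subseteq> A} \<subseteq> Pow (ground M)" using indep_subset_ground by auto
  then show ?thesis using finite_ground finite_subset by blast
qed

lemma matroid_rank_ge: "X \<in> indep M \<Longrightarrow> X \<subseteq> A \<Longrightarrow> card X \<le> matroid_rank M A"
  unfolding matroid_rank_def using finite_card_indep by (intro Max_ge) auto

lemma matroid_rank_attained:
  obtains X where "X \<in> indep M" "X \<subseteq> A" "card X = matroid_rank M A"
proof -
  have "card ` {X \<in> indep M. X \<subseteq> A} \<noteq> {}" using empty_indep by auto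
  then have "matroid_rank M A \<in> card ` {X \<in> indep M. X \<subseteq> A}"
    unfolding matroid_rank_def using finite_card_indep Max_in by blast
  then show ?thesis using that by auto
qed

lemma matroid_rank_le: "(\<And>X. X \<in> indep M \<Longrightarrow> X \<subseteq> A \<Longrightarrow> card X \<le> n) \<Longrightarrow> matroid_rank M A \<le> n"
  by (metis matroid_rank_attained)

lemma matroid_rank_indep: "X \<in> indep M \<Longrightarrow> matroid_rank M X = card X"
  by (intro antisym matroid_rank_ge matroid_rank_le card_mono finite_indep) auto

lemma indep_extend:
  assumes "X \<in> indep M" "X \<subseteq> A"
  obtains Y where "Y \<in> indep M" "X \<subseteq> Y" "Y \<subseteq> A" "card Y = matroid_rank M A"
proof -
  have "\<exists>Y\<in>indep M. X \<subseteq> Y \<and> Y \<subseteq> A \<and> card Y = matroid_rank M A"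
    using assms
  proof (induction "matroid_rank M A - card X" arbitrary: X rule: less_induct)
    case less
    show ?case
    proof (cases "card X = matroid_rank M A")
      case False
      obtain Z where Z: "Z \<in> indep M" "Z \<subseteq> A" "card Z = matroid_rank M A"
        by (rule matroid_rank_attained)
      have lt: "card X < card Z" using matroid_rank_ge[OF less.prems] False Z by simp
      then obtain e where e: "e \<in> Z - X" "insert e X \<in> indep M"
        using indep_augment less.prems Z by blast
      have "card (insert e X) = Suc (card X)" using e finite_indep[OF less.prems(1)] by simp
      then have "matroid_rank M A - card (insert e X) < matroid_rank M A - card X" using lt Z by simp
      from less.hyps[OF this e(2)] e Z less.prems show ?thesis by auto
    qed (use less.prems in auto)
  qed
  then show ?thesis using that by blast
qed

lemma rank_function_matroid: "rank_function (ground M) (matroid_rank M)"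
proof
  show "finite (ground M)" by (rule finite_ground)
next
  fix A assume "A \<subseteq> ground M"
  then show "matroid_rank M A \<le> card A"
    using finite_ground by (intro matroid_rank_le card_mono) (auto intro: finite_subset)
next
  fix A B assume "A \<subseteq> B" "B \<subseteq> ground M"
  then show "matroid_rank M A \<le> matroid_rank M B"
    by (intro matroid_rank_le matroid_rank_ge) auto
next
  fix A B assume AB: "A \<subseteq> ground M" "B \<subseteq> ground M"
  obtain I where I: "I \<in> indep M" "I \<subseteq> A \<inter> B" "card I = matroid_rank M (A \<inter> B)"
    by (rule matroid_rank_attained)
  obtain J where J: "J \<in> indep M" "I \<subseteq> J" "J \<subseteq> A \<union> B" "card J = matroid_rank M (A \<union> B)"
    using indep_extend[of I "A \<union> B"] I by blast
  have sub: "J \<inter> A \<in> indep M" "J \<inter> B \<in> indep M" using J indep_downward by blast+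
  have "card J + card I \<le> card ((J \<inter> A) \<union> (J \<inter> B)) + card ((J \<inter> A) \<inter> (J \<inter> B))"
    using I J sub finite_indep by (intro add_mono card_mono) auto
  also have "\<dots> = card (J \<inter> A) + card (J \<inter> B)"
    using card_Un_Int[OF sub[THEN finite_indep]] by simp
  also have "\<dots> \<le> matroid_rank M A + matroid_rank M B"
    using sub by (intro add_mono matroid_rank_ge) auto
  finally show "matroid_rank M (A \<union> B) + matroid_rank M (A \<inter> B) \<le> matroid_rank M A + matroid_rank M B"
    using I J by simp
qed

lemma loopless_matroid: "\<not> (\<exists>e. loop M e) \<Longrightarrow> loopless (ground M) (matroid_rank M)"
  unfolding loopless_def loop_def by (auto simp: matroid_rank_indep)

lemma coloopless_matroid:
  assumes "\<not> (\<exists>e. coloop M e)"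
  shows "coloopless (ground M) (matroid_rank M)"
  unfolding coloopless_def
proof
  interpret rank_function "ground M" "matroid_rank M" by (rule rank_function_matroid)
  fix e assume e: "e \<in> ground M"
  then obtain B where B: "basis M B" "e \<notin> B" using assms unfolding coloop_def by blast
  have BM: "B \<in> indep M" "B \<subseteq> ground M" using B indep_subset_ground unfolding basis_def by auto
  obtain Y where "Y \<in> indep M" "B \<subseteq> Y" "card Y = matroid_rank M (ground M)"
    using indep_extend[OF BM] by blast
  then have "card B = matroid_rank M (ground M)" using B unfolding basis_def by blast
  then have "matroid_rank M (ground M) \<le> matroid_rank M (ground M - {e})"
    using matroid_rank_ge[of B "ground M - {e}"] BM B by auto
  then show "matroid_rank M (ground M - {e}) = matroid_rank M (ground M)"
    using rank_mono[of "ground M - {e}" "ground M"] by auto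
qed

lemma tutte_eq:
  shows "tutte M (2::int) 0 = acyc (ground M) (matroid_rank M)"
    "tutte M (0::int) 2 = cyc (ground M) (matroid_rank M)"
    "tutte M (1::int) 1 = nbases (ground M) (matroid_rank M)"
proof -
  interpret rank_function "ground M" "matroid_rank M" by (rule rank_function_matroid)
  have le: "matroid_rank M A \<le> card A" "matroid_rank M A \<le> matroid_rank M (ground M)"
    if "A \<subseteq> ground M" for A using rank_le_card[OF that] rank_mono[OF that] by auto
  have sgn: "(-1::int) ^ (m - n) = (-1) ^ (m + n)" if "n \<le> m" for m n :: nat
    using that by (simp add: minus_one_power_iff)
  show "tutte M (2::int) 0 = acyc (ground M) (matroid_rank M)"
    unfolding tutte_def acyc_def
    by (intro sum.cong refl) (simp add: sgn le)
  show "tutte M (0::int) 2 = cyc (ground M) (matroid_rank M)"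
    unfolding tutte_def cyc_def
    by (intro sum.cong refl) (simp add: sgn le)
  show "tutte M (1::int) 1 = nbases (ground M) (matroid_rank M)"
    unfolding tutte_def nbases_def
  proof (intro sum.cong refl)
    fix A assume "A \<in> Pow (ground M)"
    then show "(1 - 1) ^ (matroid_rank M (ground M) - matroid_rank M A) * (1 - 1) ^ (card A - matroid_rank M A)
        = (of_bool (card A = matroid_rank M (ground M) \<and> matroid_rank M A = matroid_rank M (ground M)) :: int)"
      using le[of A] by (auto simp: power_0_left)
  qed
qed

section \<open>Circuits and cyclic flats\<close>

lemma dependent_contains_circuit:
  assumes "X \<subseteq> ground M" "X \<notin> indep M"
  shows "\<exists>C. circuit M C \<and> C \<subseteq> X"
proof -
  have "finite X" using assms finite_ground finite_subset by blast
  then show ?thesis using assms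
  proof (induction X rule: finite_psubset_induct)
    case (psubset X)
    show ?case
    proof (cases "\<forall>Y. Y \<subset> X \<longrightarrow> Y \<in> indep M")
      case True
      then show ?thesis using psubset unfolding circuit_def by blast
    next
      case False
      then obtain Y where "Y \<subset> X" "Y \<notin> indep M" by blast
      then show ?thesis using psubset.IH[of Y] psubset.prems by blast
    qed
  qed
qed

lemma circuit_through:
  assumes A: "A \<subseteq> ground M" and e: "e \<in> ground M" "e \<notin> A"
    and r: "matroid_rank M (insert e A) = matroid_rank M A"
  shows "\<exists>C. circuit M C \<and> e \<in> C \<and> C \<subseteq> insert e A"
proof -
  obtain I where I: "I \<in> indep M" "I \<subseteq> A" "card I = matroid_rank M A"
    by (rule matroid_rank_attained)
  have "card (insert e I) = Suc (card I)" using I e finite_indep by (subst card_insert_disjoint) auto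
  then have "insert e I \<notin> indep M"
    using matroid_rank_ge[of "insert e I" "insert e A"] r I by auto
  moreover have "insert e I \<subseteq> ground M" using I A e by auto
  ultimately obtain C where C: "circuit M C" "C \<subseteq> insert e I"
    using dependent_contains_circuit by blast
  moreover have "e \<in> C"
  proof (rule ccontr)
    assume "e \<notin> C"
    then have "C \<subseteq> I" using C by auto
    then have "C \<in> indep M" using indep_downward[OF I(1)] by simp
    then show False using C(1) unfolding circuit_def by simp
  qed
  moreover have "insert e I \<subseteq> insert e A" using I by auto
  ultimately show ?thesis by (meson subset_trans)
qed

text \<open>An element spanned by the union G of the circuits in F lies in F because F is flat; if
  it were outside G, a circuit through it would lie in F and hence put it into G.\<close>

lemma cyclic_flat_core:
  assumes F: "flat M F"
  shows "cyclic_flat M (\<Union>{C. circuit M C \<and> C \<subseteq> F})"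
proof -
  interpret rank_function "ground M" "matroid_rank M" by (rule rank_function_matroid)
  let ?G = "\<Union>{C. circuit M C \<and> C \<subseteq> F}"
  have FE: "F \<subseteq> ground M" using F unfolding flat_def by auto
  have GF: "?G \<subseteq> F" by auto
  have GE: "?G \<subseteq> ground M" using GF FE by auto
  have "matroid_rank M ?G < matroid_rank M (insert e ?G)" if e: "e \<in> ground M - ?G" for e
  proof (rule ccontr)
    assume "\<not> matroid_rank M ?G < matroid_rank M (insert e ?G)"
    then have eq: "matroid_rank M (insert e ?G) = matroid_rank M ?G"
      using rank_insert_ge[OF GE, of e] e by auto
    show False
    proof (cases "e \<in> F")
      case True
      obtain C where "circuit M C" "e \<in> C" "C \<subseteq> insert e ?G"
        using circuit_through[OF GE _ _ eq] e by auto
      then show False using True GF e by blast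
    next
      case False
      then have "e \<in> ground M - F" using e by auto
      moreover from this have "matroid_rank M (insert e F) = matroid_rank M F"
        using rank_insert_mono[OF GF FE _ eq] by simp
      ultimately show False using F unfolding flat_def by (metis less_irrefl)
    qed
  qed
  then have "flat M ?G" using GE unfolding flat_def by blast
  then show ?thesis
    unfolding cyclic_flat_def by (intro conjI exI[of _ "{C. circuit M C \<and> C \<subseteq> F}"]) simp_all
qed

lemma flat_closure:
  assumes A: "A \<subseteq> ground M"
  defines "F \<equiv> {x \<in> ground M. matroid_rank M (insert x A) = matroid_rank M A}"
  shows "flat M F" "A \<subseteq> F"
proof -
  interpret rank_function "ground M" "matroid_rank M" by (rule rank_function_matroid)
  show AF: "A \<subseteq> F" using A unfolding F_def by (auto simp: insert_absorb)
  have FE: "F \<subseteq> ground M" unfolding F_def by auto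
  have "matroid_rank M (A \<union> F) = matroid_rank M A"
    by (rule rank_absorb) (use A in \<open>auto simp: F_def\<close>)
  then have rF: "matroid_rank M F = matroid_rank M A" using AF by (simp add: Un_absorb1)
  show "flat M F"
    unfolding flat_def
  proof (intro conjI ballI FE)
    fix e assume e: "e \<in> ground M - F"
    then have "matroid_rank M A < matroid_rank M (insert e A)"
      using rank_insert_ge[OF A, of e] unfolding F_def by auto
    also have "\<dots> \<le> matroid_rank M (insert e F)" using AF FE e by (intro rank_mono) auto
    finally show "matroid_rank M F < matroid_rank M (insert e F)" using rF by simp
  qed
qed

end

text \<open>An obstruction yields a forbidden chain of cyclic flats: take the unions of circuits
  inside the closures of S and of S with a and b. The loop l lies in the smaller one, a only in the
  larger one, and c in neither.\<close>

lemma elementary_split_connected_split: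
  assumes "connected_split_matroid M"
  shows "elementary_split (ground M) (matroid_rank M)"
  unfolding elementary_split_def
proof (rule notI, elim exE conjE)
  interpret matroid M using assms unfolding connected_split_matroid_def by auto
  let ?r = "matroid_rank M"
  interpret rank_function "ground M" ?r by (rule rank_function_matroid)
  fix S l a b c
  assume S: "S \<subseteq> ground M" and el: "{l, a, b, c} \<subseteq> ground M - S" and ab: "a \<noteq> b"
    and h: "?r (insert l S) = ?r S" "?r (insert a S) = Suc (?r S)" "?r (insert b S) = Suc (?r S)"
      "?r (insert a (insert b S)) = Suc (?r S)"
      "?r (insert c (insert a (insert b S))) = Suc (Suc (?r S))"
  let ?T = "insert a (insert b S)"
  define F1 where "F1 = {x \<in> ground M. ?r (insert x S) = ?r S}"
  define F2 where "F2 = {x \<in> ground M. ?r (insert x ?T) = ?r ?T}"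
  define G1 where "G1 = \<Union>{C. circuit M C \<and> C \<subseteq> F1}"
  define G2 where "G2 = \<Union>{C. circuit M C \<and> C \<subseteq> F2}"
  have T: "?T \<subseteq> ground M" using S el by auto
  have F1: "flat M F1" "S \<subseteq> F1" unfolding F1_def by (rule flat_closure[OF S])+
  have F2: "flat M F2" "?T \<subseteq> F2" unfolding F2_def by (rule flat_closure[OF T])+
  have G: "cyclic_flat M G1" "cyclic_flat M G2"
    unfolding G1_def G2_def using cyclic_flat_core F1 F2 by auto
  have "F1 \<subseteq> F2" unfolding F1_def F2_def using rank_insert_mono[of S ?T] T by auto
  then have le: "G1 \<subseteq> G2" unfolding G1_def G2_def by auto
  have "a \<in> G2"
  proof -
    have "?r (insert a (insert b S)) = ?r (insert b S)" using h by simp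
    then obtain C where "circuit M C" "a \<in> C" "C \<subseteq> ?T"
      using circuit_through[of "insert b S" a] S el ab by auto
    then show ?thesis using F2 unfolding G2_def by blast
  qed
  moreover have "a \<notin> G1" using h unfolding G1_def F1_def by auto
  ultimately have "G1 \<subset> G2" using le by auto
  moreover have "l \<in> G1"
  proof -
    obtain C where "circuit M C" "l \<in> C" "C \<subseteq> insert l S"
      using circuit_through[of S l] S el h by auto
    moreover have "l \<in> F1" using h el unfolding F1_def by auto
    ultimately show ?thesis using F1 unfolding G1_def by blast
  qed
  moreover have "c \<notin> G2" using h unfolding G2_def F2_def by auto
  ultimately show False using assms G el unfolding connected_split_matroid_def by blast
qed

lemma uniform_matroid_is_matroid:
  assumes "uniform_matroid M"
  shows "matroid M"
proof -
  obtain k where k: "indep M = {X. X \<subseteq> ground M \<and> card X \<le> k}" and fin: "finite (ground M)"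
    using assms unfolding uniform_matroid_def by auto
  have fs: "finite X" if "X \<subseteq> ground M" for X using that fin finite_subset by blast
  show ?thesis
  proof
    show "finite (ground M)" by (rule fin)
  next
    fix X assume "X \<in> indep M" then show "X \<subseteq> ground M" unfolding k by simp
  next
    show "{} \<in> indep M" unfolding k by simp
  next
    fix X Y assume "X \<in> indep M" "Y \<subseteq> X"
    then show "Y \<in> indep M" unfolding k using card_mono[OF fs, of X Y] by auto
  next
    fix X Y assume X: "X \<in> indep M" and Y: "Y \<in> indep M" and lt: "card X < card Y"
    have "\<not> Y \<subseteq> X" using lt X card_mono[OF fs, of X Y] unfolding k by auto
    then obtain e where e: "e \<in> Y - X" by auto
    then show "\<exists>e\<in>Y - X. insert e X \<in> indep M"
      using X Y lt fs[of X] unfolding k by (intro bexI[of _ e]) auto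
  qed
qed

text \<open>In a uniform matroid a set that spans an element outside it already has full rank. So if
  l is a loop over S, no a can raise the rank of S.\<close>

lemma elementary_split_uniform:
  assumes "uniform_matroid M"
  shows "elementary_split (ground M) (matroid_rank M)"
  unfolding elementary_split_def
proof (rule notI, elim exE conjE)
  interpret matroid M using assms by (rule uniform_matroid_is_matroid)
  let ?r = "matroid_rank M"
  obtain k where k: "indep M = {X. X \<subseteq> ground M \<and> card X \<le> k}"
    using assms unfolding uniform_matroid_def by auto
  fix S l a b c
  assume S: "S \<subseteq> ground M" and el: "{l, a, b, c} \<subseteq> ground M - S"
    and h: "?r (insert l S) = ?r S" "?r (insert a S) = Suc (?r S)"
  have fS: "finite S" using S finite_ground finite_subset by blast
  obtain Y where Y: "Y \<in> indep M" "Y \<subseteq> insert a S" "card Y = ?r (insert a S)"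
    by (rule matroid_rank_attained)
  obtain X where X: "X \<in> indep M" "X \<subseteq> S" "card X = ?r S"
    by (rule matroid_rank_attained)
  have lX: "card (insert l X) = Suc (card X)"
    using X el fS by (subst card_insert_disjoint) (auto intro: finite_subset)
  then have "insert l X \<in> indep M" using X Y h el unfolding k by auto
  then have "card (insert l X) \<le> ?r S"
    using matroid_rank_ge[of "insert l X" "insert l S"] X h by auto
  then show False using X lX by simp
qed

section \<open>Direct sums and isomorphisms\<close>

text \<open>The maximum is evaluated directly on the data: independent sets of the sum are families
  of independent sets, which are maximised summand by summand.\<close>

lemma matroid_rank_direct_sum:
  assumes I: "finite I" and N: "\<And>i. i \<in> I \<Longrightarrow> matroid (N i)"
  shows "matroid_rank (direct_sum I N) (SIGMA i:I. A i) = (\<Sum>i\<in>I. matroid_rank (N i) (A i))"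
  unfolding matroid_rank_def[of "direct_sum I N"]
proof (rule Max_eqI)
  let ?S = "{X \<in> indep (direct_sum I N). X \<subseteq> (SIGMA i:I. A i)}"
  have "?S \<subseteq> Pow (SIGMA i:I. ground (N i))"
    using matroid.indep_subset_ground[OF N] unfolding direct_sum_def by fastforce
  moreover have "finite (SIGMA i:I. ground (N i))"
    using I N matroid.finite_ground by (intro finite_SigmaI) auto
  ultimately show "finite (card ` ?S)" using finite_subset by blast
next
  fix m assume "m \<in> card ` {X \<in> indep (direct_sum I N). X \<subseteq> (SIGMA i:I. A i)}"
  then obtain X where X: "\<forall>i\<in>I. X i \<in> indep (N i)" "(SIGMA i:I. X i) \<subseteq> (SIGMA i:I. A i)"
    and m: "m = card (SIGMA i:I. X i)" unfolding direct_sum_def by auto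
  have "m = (\<Sum>i\<in>I. card (X i))"
    unfolding m using I N X(1) matroid.finite_indep by (intro card_SigmaI) auto
  also have "\<dots> \<le> (\<Sum>i\<in>I. matroid_rank (N i) (A i))"
    using X N by (intro sum_mono matroid.matroid_rank_ge) auto
  finally show "m \<le> (\<Sum>i\<in>I. matroid_rank (N i) (A i))" .
next
  have "\<exists>X. X \<in> indep (N i) \<and> X \<subseteq> A i \<and> card X = matroid_rank (N i) (A i)" if "i \<in> I" for i
    using matroid.matroid_rank_attained[OF N[OF that], of "A i"] by blast
  then obtain X where X: "\<And>i. i \<in> I \<Longrightarrow> X i \<in> indep (N i)"
    "\<And>i. i \<in> I \<Longrightarrow> X i \<subseteq> A i" "\<And>i. i \<in> I \<Longrightarrow> card (X i) = matroid_rank (N i) (A i)"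
    by metis
  have "card (SIGMA i:I. X i) = (\<Sum>i\<in>I. card (X i))"
    using I N X(1) matroid.finite_indep by (intro card_SigmaI) auto
  then have "card (SIGMA i:I. X i) = (\<Sum>i\<in>I. matroid_rank (N i) (A i))" using X(3) by simp
  moreover have "(SIGMA i:I. X i) \<in> indep (direct_sum I N)"
    using X(1) unfolding direct_sum_def by auto
  moreover have "(SIGMA i:I. X i) \<subseteq> (SIGMA i:I. A i)" using X(2) by (intro Sigma_mono) auto
  ultimately show "(\<Sum>i\<in>I. matroid_rank (N i) (A i))
      \<in> card ` {X \<in> indep (direct_sum I N). X \<subseteq> (SIGMA i:I. A i)}"
    by (intro image_eqI[of _ _ "SIGMA i:I. X i"]) simp_all
qed

lemma tutte_direct_sum:
  assumes I: "finite I" and N: "\<And>i. i \<in> I \<Longrightarrow> matroid (N i)"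
  shows "tutte (direct_sum I N) x y = (\<Prod>i\<in>I. tutte (N i) x y)"
proof -
  let ?E = "\<lambda>i. ground (N i)" and ?r = "\<lambda>i. matroid_rank (N i)" and ?D = "direct_sum I N"
  define t where "t i A = (x - 1) ^ (?r i (?E i) - ?r i A) * (y - 1) ^ (card A - ?r i A)" for i A
  have gD: "ground ?D = (SIGMA i:I. ?E i)" unfolding direct_sum_def by simp
  have rk: "matroid_rank ?D (SIGMA i:I. A i) = (\<Sum>i\<in>I. ?r i (A i))" for A
    by (rule matroid_rank_direct_sum[OF I N])
  have fin: "finite (?E i)" if "i \<in> I" for i using matroid.finite_ground N that by blast
  have summand: "(x - 1) ^ (matroid_rank ?D (ground ?D) - matroid_rank ?D (SIGMA i:I. g i)) *
      (y - 1) ^ (card (SIGMA i:I. g i) - matroid_rank ?D (SIGMA i:I. g i)) = (\<Prod>i\<in>I. t i (g i))"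
    if g: "g \<in> (\<Pi>\<^sub>E i\<in>I. Pow (?E i))" for g
  proof -
    have gi: "g i \<subseteq> ?E i" if "i \<in> I" for i using g that by auto
    have le: "?r i (g i) \<le> ?r i (?E i)" "?r i (g i) \<le> card (g i)" if "i \<in> I" for i
      using rank_function.rank_mono[OF matroid.rank_function_matroid[OF N[OF that]] gi[OF that] order_refl]
        rank_function.rank_le_card[OF matroid.rank_function_matroid[OF N[OF that]] gi[OF that]] by auto
    have card: "card (SIGMA i:I. g i) = (\<Sum>i\<in>I. card (g i))"
      using I gi fin by (intro card_SigmaI) (auto intro: finite_subset)
    \<comment> \<open>Truncated subtraction commutes with the sum because \<open>le\<close> rules
      out truncation in every summand.\<close>
    have "(\<Sum>i\<in>I. ?r i (?E i)) - (\<Sum>i\<in>I. ?r i (g i)) = (\<Sum>i\<in>I. ?r i (?E i) - ?r i (g i))"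
      "(\<Sum>i\<in>I. card (g i)) - (\<Sum>i\<in>I. ?r i (g i)) = (\<Sum>i\<in>I. card (g i) - ?r i (g i))"
      using le by (auto intro!: sum_subtractf_nat[symmetric])
    then show ?thesis
      unfolding gD rk card t_def
      by (simp add: power_sum prod.distrib)
  qed
  have "tutte ?D x y = (\<Sum>g\<in>(\<Pi>\<^sub>E i\<in>I. Pow (?E i)). \<Prod>i\<in>I. t i (g i))"
    unfolding tutte_def
  proof (rule sum.reindex_bij_witness[where j = "\<lambda>A. \<lambda>i\<in>I. A `` {i}" and i = "Sigma I"])
    fix A assume A: "A \<in> Pow (ground ?D)"
    then show "(SIGMA i:I. (\<lambda>i\<in>I. A `` {i}) i) = A"
      unfolding gD by auto
    show g: "(\<lambda>i\<in>I. A `` {i}) \<in> (\<Pi>\<^sub>E i\<in>I. Pow (?E i))" using A unfolding gD by auto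
    show "(\<Prod>i\<in>I. t i ((\<lambda>i\<in>I. A `` {i}) i)) = (x - 1) ^ (matroid_rank ?D (ground ?D) - matroid_rank ?D A) *
      (y - 1) ^ (card A - matroid_rank ?D A)"
      using summand[OF g] \<open>(SIGMA i:I. (\<lambda>i\<in>I. A `` {i}) i) = A\<close> by simp
  next
    fix g assume g: "g \<in> (\<Pi>\<^sub>E i\<in>I. Pow (?E i))"
    then show "Sigma I g \<in> Pow (ground ?D)" unfolding gD by auto
    show "(\<lambda>i\<in>I. Sigma I g `` {i}) = g"
    proof
      fix i
      show "(\<lambda>i\<in>I. Sigma I g `` {i}) i = g i"
        using PiE_arb[OF g, of i] by (cases "i \<in> I") auto
    qed
  qed
  also have "\<dots> = (\<Prod>i\<in>I. \<Sum>A\<in>Pow (?E i). t i A)"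
    using I fin by (intro prod_sum_PiE[symmetric]) auto
  also have "\<dots> = (\<Prod>i\<in>I. tutte (N i) x y)"
    unfolding tutte_def t_def ..
  finally show ?thesis .
qed

lemma matroid_rank_iso:
  assumes f: "inj_on f (ground M)" "\<And>X. X \<subseteq> ground M \<Longrightarrow> X \<in> indep M \<longleftrightarrow> f ` X \<in> indep N"
    and A: "A \<subseteq> ground M"
  shows "matroid_rank N (f ` A) = matroid_rank M A"
proof -
  have c: "card (f ` X) = card X" if "X \<subseteq> A" for X
    by (rule card_image, rule inj_on_subset[OF f(1)]) (use that A in auto)
  have "card ` {Y \<in> indep N. Y \<subseteq> f ` A} = card ` {X \<in> indep M. X \<subseteq> A}"
  proof (intro equalityI subsetI)
    fix m assume "m \<in> card ` {Y \<in> indep N. Y \<subseteq> f ` A}"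
    then obtain X where X: "X \<subseteq> A" "f ` X \<in> indep N" "m = card (f ` X)"
      by (auto simp: subset_image_iff)
    then have "m = card X" using c by simp
    then show "m \<in> card ` {X \<in> indep M. X \<subseteq> A}" using X A f(2)[of X] by auto
  next
    fix m assume "m \<in> card ` {X \<in> indep M. X \<subseteq> A}"
    then obtain X where X: "X \<subseteq> A" "X \<in> indep M" "m = card X" by auto
    then have "m = card (f ` X)" using c by simp
    then show "m \<in> card ` {Y \<in> indep N. Y \<subseteq> f ` A}" using X A f(2)[of X] by auto
  qed
  then show ?thesis unfolding matroid_rank_def by simp
qed

lemma tutte_iso:
  assumes f: "bij_betw f (ground M) (ground N)"
    "\<And>X. X \<subseteq> ground M \<Longrightarrow> X \<in> indep M \<longleftrightarrow> f ` X \<in> indep N"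
  shows "tutte N x y = tutte M x y"
proof -
  have inj: "inj_on f (ground M)" and im: "ground N = f ` ground M"
    using f(1) unfolding bij_betw_def by auto
  have r: "matroid_rank N (f ` A) = matroid_rank M A" if "A \<subseteq> ground M" for A
    by (rule matroid_rank_iso[OF inj f(2) that])
  have "bij_betw ((`) f) (Pow (ground M)) (Pow (ground N))"
    using f(1) by (rule bij_betw_Pow)
  then have "tutte N x y = (\<Sum>A\<in>Pow (ground M). (x - 1) ^ (matroid_rank N (ground N) - matroid_rank N (f ` A))
      * (y - 1) ^ (card (f ` A) - matroid_rank N (f ` A)))"
    unfolding tutte_def by (rule sum.reindex_bij_betw[symmetric])
  also have "\<dots> = tutte M x y"
    unfolding tutte_def
  proof (rule sum.cong)
    fix A assume "A \<in> Pow (ground M)"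
    then have A: "A \<subseteq> ground M" by simp
    then have "card (f ` A) = card A" by (intro card_image inj_on_subset[OF inj])
    then show "(x - 1) ^ (matroid_rank N (ground N) - matroid_rank N (f ` A))
      * (y - 1) ^ (card (f ` A) - matroid_rank N (f ` A)) =
      (x - 1) ^ (matroid_rank M (ground M) - matroid_rank M A) * (y - 1) ^ (card A - matroid_rank M A)"
      using r[OF A] r[of "ground M"] im by simp
  qed simp
  finally show ?thesis .
qed

lemma summand_loopless_coloopless:
  assumes I: "finite I" and N: "\<And>i. i \<in> I \<Longrightarrow> matroid (N i)"
    and ll: "loopless (ground (direct_sum I N)) (matroid_rank (direct_sum I N))"
    and cl: "coloopless (ground (direct_sum I N)) (matroid_rank (direct_sum I N))"
    and i: "i \<in> I"
  shows "loopless (ground (N i)) (matroid_rank (N i))" "coloopless (ground (N i)) (matroid_rank (N i))"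
proof -
  let ?D = "direct_sum I N"
  have gD: "ground ?D = (SIGMA i:I. ground (N i))" unfolding direct_sum_def by simp
  have rk: "matroid_rank ?D (SIGMA i:I. A i) = (\<Sum>i\<in>I. matroid_rank (N i) (A i))" for A
    by (rule matroid_rank_direct_sum[OF I N])
  show "loopless (ground (N i)) (matroid_rank (N i))"
    unfolding loopless_def
  proof
    fix a assume a: "a \<in> ground (N i)"
    \<comment> \<open>Written as a family of fibres, all but one of them empty, the singleton fits
      the rank formula for sums.\<close>
    have "{(i, a)} = (SIGMA j:I. if j = i then {a} else {})" using i by (auto split: if_splits)
    then have "matroid_rank ?D {(i, a)} = (\<Sum>j\<in>I. matroid_rank (N j) (if j = i then {a} else {}))"
      using rk by simp
    also have "\<dots> = matroid_rank (N i) {a} + (\<Sum>j\<in>I - {i}. matroid_rank (N j) (if j = i then {a} else {}))"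
      using I i by (subst sum.remove[of _ i]) auto
    also have "(\<Sum>j\<in>I - {i}. matroid_rank (N j) (if j = i then {a} else {})) = 0"
      using rank_function.rank_empty[OF matroid.rank_function_matroid[OF N]] by (intro sum.neutral) auto
    finally show "matroid_rank (N i) {a} = 1"
      using ll i a unfolding loopless_def gD by auto
  qed
  show "coloopless (ground (N i)) (matroid_rank (N i))"
    unfolding coloopless_def
  proof
    fix a assume a: "a \<in> ground (N i)"
    let ?A = "\<lambda>j. if j = i then ground (N i) - {a} else ground (N j)"
    have "ground ?D - {(i, a)} = (SIGMA j:I. ?A j)"
      unfolding gD by (auto split: if_splits)
    then have "matroid_rank ?D (ground ?D - {(i, a)}) = (\<Sum>j\<in>I. matroid_rank (N j) (?A j))"
      using rk by simp
    also have "\<dots> = matroid_rank (N i) (ground (N i) - {a}) + (\<Sum>j\<in>I - {i}. matroid_rank (N j) (?A j))"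
      using I i by (subst sum.remove[of _ i]) auto
    also have "(\<Sum>j\<in>I - {i}. matroid_rank (N j) (?A j)) = (\<Sum>j\<in>I - {i}. matroid_rank (N j) (ground (N j)))"
      by (rule sum.cong) auto
    finally have "matroid_rank ?D (ground ?D - {(i, a)})
      = matroid_rank (N i) (ground (N i) - {a}) + (\<Sum>j\<in>I - {i}. matroid_rank (N j) (ground (N j)))" .
    moreover have "matroid_rank ?D (ground ?D)
      = matroid_rank (N i) (ground (N i)) + (\<Sum>j\<in>I - {i}. matroid_rank (N j) (ground (N j)))"
      unfolding gD rk using I i by (subst sum.remove[of _ i]) auto
    moreover have "(i, a) \<in> ground ?D" using i a unfolding gD by auto
    ultimately show "matroid_rank (N i) (ground (N i) - {a}) = matroid_rank (N i) (ground (N i))"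
      using cl unfolding coloopless_def by fastforce
  qed
qed

theorem theorem1p3:
  fixes M :: "'a matroid_data"
  assumes "split_matroid M"
    and "\<not> (\<exists>e. loop M e)"
    and "\<not> (\<exists>e. coloop M e)"
  shows "tutte M (2::int) 0 * tutte M 0 2 \<ge> (tutte M 1 1)\<^sup>2"
proof -
  interpret matroid M using assms(1) unfolding split_matroid_def by auto
  obtain n k and N :: "nat \<Rightarrow> 'a matroid_data" where k: "k < n" "connected_split_matroid (N k)"
    and u: "\<And>i. i < n \<Longrightarrow> i \<noteq> k \<Longrightarrow> uniform_matroid (N i)"
    and iso: "isomorphic M (direct_sum {..<n} N)"
    using assms(1) unfolding split_matroid_def by metis
  define D where "D = direct_sum {..<n} N"
  obtain f where f: "bij_betw f (ground M) (ground D)"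
    "\<And>X. X \<subseteq> ground M \<Longrightarrow> X \<in> indep M \<longleftrightarrow> f ` X \<in> indep D"
    using iso unfolding isomorphic_def D_def by blast
  have inj: "inj_on f (ground M)" and im: "ground D = f ` ground M"
    using f(1) unfolding bij_betw_def by auto
  have r: "matroid_rank D (f ` A) = matroid_rank M A" if "A \<subseteq> ground M" for A
    by (rule matroid_rank_iso[OF inj f(2) that])
  have N: "matroid (N i)" if "i \<in> {..<n}" for i
    using that k u uniform_matroid_is_matroid unfolding connected_split_matroid_def by (cases "i = k") auto
  have es: "elementary_split (ground (N i)) (matroid_rank (N i))" if "i \<in> {..<n}" for i
    using that k u elementary_split_uniform elementary_split_connected_split by (cases "i = k") auto
  \<comment> \<open>\<open>loop\<close> and \<open>coloop\<close> are only excluded for M; the rank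
    conditions reach D along f and descend from there to the summands.\<close>
  have ll: "loopless (ground D) (matroid_rank D)"
    using loopless_matroid[OF assms(2)] r[of "{e}" for e] unfolding loopless_def im by auto
  have cl: "coloopless (ground D) (matroid_rank D)"
    unfolding coloopless_def im
  proof
    fix d assume "d \<in> f ` ground M"
    then obtain e where e: "e \<in> ground M" and d: "d = f e" by blast
    have "f ` ground M - {d} = f ` (ground M - {e})"
      using inj e unfolding d by (auto simp: inj_on_def)
    then show "matroid_rank D (f ` ground M - {d}) = matroid_rank D (f ` ground M)"
      using coloopless_matroid[OF assms(3)] r[of "ground M - {e}"] r[of "ground M"] e
      unfolding coloopless_def by auto
  qed
  have mw: "merino_welsh (ground (N i)) (matroid_rank (N i))" if i: "i \<in> {..<n}" for i
    using merino_welsh_elementary_split matroid.rank_function_matroid[OF N[OF i]] es[OF i]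
      summand_loopless_coloopless[OF _ N ll[unfolded D_def] cl[unfolded D_def] i] by simp
  have T: "tutte M x y = (\<Prod>i\<in>{..<n}. tutte (N i) x y)" for x y :: int
    using tutte_iso[OF f, of x y] tutte_direct_sum[of "{..<n}" N x y] N unfolding D_def by simp
  have "(tutte M (1::int) 1)\<^sup>2 = (\<Prod>i\<in>{..<n}. (tutte (N i) 1 1)\<^sup>2)"
    unfolding T by (simp add: prod_power_distrib)
  also have "\<dots> \<le> (\<Prod>i\<in>{..<n}. tutte (N i) 2 0 * tutte (N i) 0 2)"
    using mw matroid.tutte_eq[OF N] by (intro prod_mono) (auto simp: merino_welsh_def)
  also have "\<dots> = tutte M 2 0 * tutte M 0 2"
    unfolding T by (simp add: prod.distrib)
  finally show ?thesis .
qed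

end
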